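(* Let $(\mathbf{m},\mathbf{d})$ be an MD pair, with $\mathbf{m}$ of magnitude $n$. Then the map $\mathcal{B}\mapsto\mathbf{v}_{\mathcal{B}}$ defines a bijection between the set $\{\mathcal{B} : \mathcal{B}\text{ a skewed binary partition of }[0,n],\ \mathrm{type}(\mathcal{B})\in\Omega_{\mathbf{m}}\}$ and the set of vertices of $\mathrm{PF}(\mathbf{m},\mathbf{d})$. Moreover, for each such $\mathcal{B}$, the normal cone of $\mathrm{PF}(\mathbf{m},\mathbf{d})$ at $\mathbf{v}_{\mathcal{B}}$ is $\tilde\sigma_{\mathcal{B}}$.
   Context: Parking function polytope. For nonzero $\mathbf{u}=(u_1,\dots,u_n)$ with $0\le u_1\le\cdots\le u_n$, a vector $\mathbf{a}\in\mathbb{R}^n_{\ge0}$ with nondecreasing rearrangement $b_1\le\cdots\le b_n$ is a $\mathbf{u}$-parking function if $b_i\le u_i$ for all $i$; $\mathrm{PF}(\mathbf{u})$ is the convex hull of all $\mathbf{u}$-parking functions. MD pair. Let $d_1<\cdots<d_\ell$ ($\ell\ge1$) be the distinct positive numbers appearing in $\mathbf{u}$, $m_0$ the number of zeros in $\mathbf{u}$, and $m_i$ the number of entries equal to $d_i$. Then $\mathbf{m}=(m_0,m_1,\dots,m_\ell)$ is the multiplicity vector of $\mathbf{u}$ (of magnitude $n=m_0+\cdots+m_\ell$), $\mathbf{d}=(d_1,\dots,d_\ell)$ its data vector, and $(\mathbf{m},\mathbf{d})$ its MD pair; $\mathbf{u}$ is recovered from $(\mathbf{m},\mathbf{d})$,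 and $\mathrm{PF}(\mathbf{m},\mathbf{d}):=\mathrm{PF}(\mathbf{u})$. Skewed binary partitions. A skewed binary partition of $[0,n]=\{0,\dots,n\}$ is an ordered tuple $\mathcal{B}=(B_{-1},B_0,B_1,\dots,B_k)$, $k\ge0$, of disjoint subsets with union $[0,n]$, each labelled homogeneous or non-homogeneous, such that: $B_{-1}$ is non-homogeneous, and $B_0$ is homogeneous if $|B_0|\ge2$; $0\in B_{-1}\cup B_0$, and if $0\in B_{-1}$ then $|B_{-1}|\ge2$ and $B_0=\emptyset$; for $0\le i\le k$, if $B_i$ is a singleton it is non-homogeneous; $B_i\ne\emptyset$ for $1\le i\le k$. Preorder and cone. $\preceq_{\mathcal{B}}$ is the preorder on $[0,n]$ with $p\preceq_{\mathcal{B}}q$ iff $p=q$, or $p\in B_i,q\in B_j$ with $i<j$, or $p,q$ lie in a common homogeneous block. The sliced preorder cone is $\tilde\sigma_{\mathcal{B}}=\{(c_1,\dots,c_n)\in\mathbb{R}^n : c_0=0\text{ and }c_i\le c_j\text{ whenever } i\preceq_{\mathcal{B}}j,\ i,j\in[0,n]\}$. Type. $\mathrm{type}(\mathcal{B})=(b_{-1},b_0,\dots,b_k)$, where entries are nonnegative integers, possibly decorated by $\circ$ or $\star$: for $1\le i\le k$, $b_i=|B_i|$ if $B_i$ is non-homogeneous and $b_i=|B_i|^\star$ if homogeneous; if $0\in B_0$ then $b_0=(|B_0|-1)^\circ$ and $b_{-1}=|B_{-1}|$; if $0\in B_{-1}$ then $b_0=0$ (undecorated, distinct from $0^\circ$)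 and $b_{-1}=|B_{-1}|-1$. $\Omega_{\mathbf{m}}$. Let $r=m_1+\cdots+m_\ell$. $\Omega_{\mathbf{m}}=\{\mathbf{a}_0,\dots,\mathbf{a}_r\}$, where $\mathbf{a}_0=(m_0,0,m_1,\dots,m_\ell)$ if $m_0>0$, $\mathbf{a}_0=(0,0^\circ,m_1,\dots,m_\ell)$ if $m_0=0$; for $1\le i<r$, $\mathbf{a}_i=(m_0+i,0^\circ,m_1+\cdots+m_g-i,m_{g+1},\dots,m_\ell)$, where $g$ is the unique positive integer with $m_1+\cdots+m_{g-1}\le i<m_1+\cdots+m_g$; and $\mathbf{a}_r=(n,0^\circ)$. The point $\mathbf{v}_{\mathcal{B}}$. For $\mathcal{B}=(B_{-1},B_0,\dots,B_k)$ with $\mathrm{type}(\mathcal{B})\in\Omega_{\mathbf{m}}$, $\mathbf{v}_{\mathcal{B}}=(v_1,\dots,v_n)$ with $v_i=0$ if $i\in B_{-1}$ and $v_i=d_{\ell-k+j}$ if $i\in B_j$ for some $j\in\{1,\dots,k\}$. Normal cone of a polytope $P$ at a face $F$: $\{\mathbf{w}\in\mathbb{R}^n : \mathbf{w}\cdot\mathbf{x}\ge\mathbf{w}\cdot\mathbf{y}\ \forall \mathbf{x}\in F,\mathbf{y}\in P\}$. *)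

theory Defs
  imports "HOL-Analysis.Analysis" "HOL-Library.Multiset"
begin

text \<open>
  The space \<open>\<real>^n\<close> is \<open>real ^ 'n\<close> with \<open>n = CARD('n)\<close>: the finite type \<open>'n\<close> plays the role of
  the index set \<open>{1..n}\<close>, and \<open>'n option\<close> that of \<open>{0..n}\<close>, with \<open>None\<close> for \<open>0\<close> and \<open>Some i\<close>
  for \<open>i \<ge> 1\<close>. Nothing below depends on a linear order of the coordinates.
  Finite sequences that do have an order (\<open>u\<close>, \<open>m\<close>, \<open>d\<close>, types) are lists.
\<close>

section \<open>Parking function polytopes\<close>

definition valid_bound :: "real list \<Rightarrow> bool" where
  "valid_bound u \<longleftrightarrow> sorted u \<and> (\<forall>x\<in>set u. 0 \<le> x) \<and> (\<exists>x\<in>set u. x \<noteq> 0)"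

definition nondec_rearrangement :: "real ^ 'n \<Rightarrow> real list" where
  "nondec_rearrangement a = sorted_list_of_multiset (image_mset (\<lambda>i. a $ i) (mset_set UNIV))"

text \<open>Meaningful for \<open>length u = CARD('n)\<close> only.\<close>

definition parking_functions :: "real list \<Rightarrow> (real ^ 'n) set" where
  "parking_functions u =
     {a. (\<forall>i. 0 \<le> a $ i) \<and> (\<forall>i<CARD('n). nondec_rearrangement a ! i \<le> u ! i)}"

definition PF :: "real list \<Rightarrow> (real ^ 'n) set" where
  "PF u = convex hull (parking_functions u)"

section \<open>MD pairs\<close>

text \<open>
  The list \<open>m = [m\<^sub>0, m\<^sub>1, \<dots>, m\<^sub>\<ell>]\<close> has \<open>m ! i = m\<^sub>i\<close>, whereas
  \<open>d = [d\<^sub>1, \<dots>, d\<^sub>\<ell>]\<close> has \<open>d ! (i - 1) = d\<^sub>i\<close>.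
\<close>

definition data_vector :: "real list \<Rightarrow> real list" where
  "data_vector u = sorted_list_of_set {x \<in> set u. 0 < x}"

definition multiplicity_vector :: "real list \<Rightarrow> nat list" where
  "multiplicity_vector u = count_list u 0 # map (count_list u) (data_vector u)"

definition is_MD_pair :: "nat list \<Rightarrow> real list \<Rightarrow> bool" where
  "is_MD_pair m d \<longleftrightarrow>
     (\<exists>u. valid_bound u \<and> m = multiplicity_vector u \<and> d = data_vector u)"

definition magnitude :: "nat list \<Rightarrow> nat" where
  "magnitude m = sum_list m"

definition bound_of_MD :: "nat list \<Rightarrow> real list \<Rightarrow> real list" where
  "bound_of_MD m d = concat (map2 replicate m (0 # d))"

definition PF_MD :: "nat list \<Rightarrow> real list \<Rightarrow> (real ^ 'n) set" where
  "PF_MD m d = PF (bound_of_MD m d)"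

lemma count_concat_replicate:
  assumes "distinct xs"
  shows "count_list (concat (map (\<lambda>x. replicate (f x) x) xs)) y = (if y \<in> set xs then f y else 0)"
  using assms
proof (induction xs)
  case (Cons a xs)
  have "count_list (replicate k a) y = (if y = a then k else 0)" for k
    by (induction k) auto
  with Cons show ?case by auto
qed simp

lemma sorted_concat_replicate:
  assumes "sorted xs"
  shows "sorted (concat (map (\<lambda>x. replicate (f x) x) xs))"
  using assms by (induction xs) (auto simp: sorted_append)

text \<open>The vector \<open>u\<close> is recovered from its MD pair.\<close>

lemma bound_of_MD_recovers:
  assumes "valid_bound u"
  shows "bound_of_MD (multiplicity_vector u) (data_vector u) = u"
proof -
  let ?xs = "0 # data_vector u"
  have eq: "bound_of_MD (multiplicity_vector u) (data_vector u)
      = concat (map (\<lambda>x. replicate (count_list u x) x) ?xs)"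
    by (simp add: bound_of_MD_def multiplicity_vector_def zip_map1 zip_same_conv_map
        o_def split_def)
  have st: "set ?xs = insert 0 {x \<in> set u. 0 < x}"
    by (simp add: data_vector_def)
  have di: "distinct ?xs" and so: "sorted ?xs"
    by (auto simp: data_vector_def)
  have sub: "set u \<subseteq> set ?xs"
    using assms unfolding st valid_bound_def by fastforce
  have "mset (concat (map (\<lambda>x. replicate (count_list u x) x) ?xs)) = mset u"
  proof (rule multiset_eqI)
    fix y
    show "count (mset (concat (map (\<lambda>x. replicate (count_list u x) x) ?xs))) y = count (mset u) y"
      using sub unfolding count_mset count_concat_replicate[OF di]
      by (auto simp: count_list_0_iff)
  qed
  then show ?thesis
    unfolding eq using sorted_concat_replicate[OF so] assms
    by (metis properties_for_sort valid_bound_def)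
qed

lemma length_bound_of_MD:
  assumes "length m = Suc (length d)"
  shows "length (bound_of_MD m d) = magnitude m"
proof -
  have "length (concat (map2 replicate m xs)) = sum_list m" if "length m = length xs"
    for xs :: "real list"
    using that by (induction m xs rule: list_induct2) auto
  with assms show ?thesis
    unfolding bound_of_MD_def magnitude_def by simp
qed

section \<open>Skewed binary partitions\<close>

datatype label = Homogeneous | Nonhomogeneous

text \<open>
  A tuple \<open>(B\<^sub>-\<^sub>1, B\<^sub>0, B\<^sub>1, \<dots>, B\<^sub>k)\<close> of labelled blocks is a list whose entry at
  position \<open>j + 1\<close> is \<open>B\<^sub>j\<close>; thus \<open>k = length B - 2\<close>.
\<close>

type_synonym 'n blocks = "('n option set \<times> label) list"

definition block :: "'n blocks \<Rightarrow> nat \<Rightarrow> 'n option set" where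
  "block B i = fst (B ! i)"

definition homogeneous :: "'n blocks \<Rightarrow> nat \<Rightarrow> bool" where
  "homogeneous B i \<longleftrightarrow> snd (B ! i) = Homogeneous"

text \<open>
  The last clause fixes a convention: the label of an empty \<open>B\<^sub>0\<close> carries no information,
  and it is normalized so that equality of partitions does not depend on it.
\<close>

definition skewed_binary_partition :: "'n::finite blocks \<Rightarrow> bool" where
  "skewed_binary_partition B \<longleftrightarrow>
     2 \<le> length B \<and>
     (\<forall>i<length B. \<forall>j<length B. i \<noteq> j \<longrightarrow> block B i \<inter> block B j = {}) \<and>
     (\<Union>i<length B. block B i) = UNIV \<and>
     \<not> homogeneous B 0 \<and>
     (2 \<le> card (block B 1) \<longrightarrow> homogeneous B 1) \<and>
     None \<in> block B 0 \<union> block B 1 \<and>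
     (None \<in> block B 0 \<longrightarrow> 2 \<le> card (block B 0) \<and> block B 1 = {}) \<and>
     (\<forall>i. 1 \<le> i \<and> i < length B \<and> card (block B i) = 1 \<longrightarrow> \<not> homogeneous B i) \<and>
     (\<forall>i. 2 \<le> i \<and> i < length B \<longrightarrow> block B i \<noteq> {}) \<and>
     (block B 1 = {} \<longrightarrow> \<not> homogeneous B 1)"

definition sbp_le :: "'n blocks \<Rightarrow> 'n option \<Rightarrow> 'n option \<Rightarrow> bool" where
  "sbp_le B p q \<longleftrightarrow>
     p = q \<or>
     (\<exists>i j. i < j \<and> j < length B \<and> p \<in> block B i \<and> q \<in> block B j) \<or>
     (\<exists>i<length B. homogeneous B i \<and> p \<in> block B i \<and> q \<in> block B i)"

text \<open>The coordinate \<open>c\<^sub>p\<close> for \<open>p \<in> {0..n}\<close>, with \<open>c\<^sub>0 = 0\<close>.\<close>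

fun coord0 :: "real ^ 'n \<Rightarrow> 'n option \<Rightarrow> real" where
  "coord0 c None = 0"
| "coord0 c (Some i) = c $ i"

definition sliced_preorder_cone :: "'n blocks \<Rightarrow> (real ^ 'n) set" where
  "sliced_preorder_cone B = {c. \<forall>p q. sbp_le B p q \<longrightarrow> coord0 c p \<le> coord0 c q}"

section \<open>Types\<close>

text \<open>\<open>Circ b\<close> and \<open>Star b\<close> are the decorated entries \<open>b\<^sup>\<circ>\<close> and \<open>b\<^sup>\<star>\<close>.\<close>

datatype type_entry = Plain nat | Circ nat | Star nat

definition sbp_type :: "'n blocks \<Rightarrow> type_entry list" where
  "sbp_type B =
     (if None \<in> block B 1
      then [Plain (card (block B 0)), Circ (card (block B 1) - 1)]
      else [Plain (card (block B 0) - 1), Plain 0]) @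
     map (\<lambda>i. if homogeneous B i then Star (card (block B i)) else Plain (card (block B i)))
       [2..<length B]"

definition Omega_entry :: "nat list \<Rightarrow> nat \<Rightarrow> type_entry list" where
  "Omega_entry m i =
     (let l = length m - 1; r = (\<Sum>j=1..l. m ! j) in
      if i = 0 then
        (if 0 < m ! 0 then [Plain (m ! 0), Plain 0] else [Plain 0, Circ 0]) @ map Plain (tl m)
      else if i < r then
        (let g = (THE g. 1 \<le> g \<and> g \<le> l \<and> (\<Sum>j=1..g-1. m ! j) \<le> i \<and> i < (\<Sum>j=1..g. m ! j)) in
         [Plain (m ! 0 + i), Circ 0, Plain ((\<Sum>j=1..g. m ! j) - i)] @
         map Plain (drop (g + 1) m))
      else [Plain (magnitude m), Circ 0])"

definition Omega :: "nat list \<Rightarrow> type_entry list set" where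
  "Omega m = Omega_entry m ` {0..(\<Sum>j=1..length m - 1. m ! j)}"

section \<open>The points \<open>v\<^sub>B\<close> and normal cones\<close>

text \<open>
  Intended for partitions whose type lies in \<open>Omega m\<close>: then \<open>B\<^sub>0 \<subseteq> {0}\<close>, so every \<open>i \<ge> 1\<close>
  lies in \<open>B\<^sub>-\<^sub>1\<close> or in a unique \<open>B\<^sub>j\<close> with \<open>1 \<le> j \<le> k\<close>, and \<open>k \<le> \<ell>\<close>. The value
  \<open>d ! (\<ell> - k + j - 1)\<close> is the component of \<open>d\<close> with (one-based) index \<open>\<ell> - k + j\<close>.
\<close>

definition sbp_point :: "real list \<Rightarrow> 'n blocks \<Rightarrow> real ^ 'n" where
  "sbp_point d B =
     (\<chi> i. if Some i \<in> block B 0 then 0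
           else (let l = length d; k = length B - 2;
                     j = (THE j. 1 \<le> j \<and> j \<le> k \<and> Some i \<in> block B (j + 1))
                 in d ! (l - k + j - 1)))"

definition normal_cone :: "(real ^ 'n) set \<Rightarrow> (real ^ 'n) set \<Rightarrow> (real ^ 'n) set" where
  "normal_cone P F = {w. \<forall>x\<in>F. \<forall>y\<in>P. w \<bullet> x \<ge> w \<bullet> y}"

end

theory Submission
  imports Defs
begin

text \<open>
  For each \<open>z\<close> between the number of zeros of \<open>u\<close> and \<open>n\<close>, consider the points \<open>x\<close> whose entries are
  \<open>z\<close> zeros and the \<open>n - z\<close> largest entries of \<open>u\<close>. An extreme point of the polytope is a parking
  function, and any parking function not of this form is the midpoint of two others. Conversely, the
  normal cone at such a point is read off by exchanging two coordinates, lowering one to zero and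
  raising a zero, and the rearrangement inequality shows that these conditions suffice. The resulting
  cone is full-dimensional, so the point is extreme. The level sets of \<open>x\<close>, with the index \<open>0\<close> put
  among the zeros of \<open>x\<close> exactly when \<open>x\<close> has zeros and no more of them than \<open>u\<close>, form the skewed
  binary partition belonging to \<open>x\<close>.
\<close>

section \<open>Parking functions and rearrangements\<close>

text \<open>Turns an equality of multisets into a bijective assignment of list positions to
  coordinates, since the index type has no order of its own. To obtain \<open>f\<close>, enumerate
  the index type as a list, take the permutation relating the two lists, and compose it with the
  inverse of the enumeration.\<close>

lemma image_mset_eq_mset_iff:
  fixes g :: "'n::finite \<Rightarrow> 'a"
  shows "image_mset g (mset_set UNIV) = mset ys \<longleftrightarrow>
    (\<exists>f. bij_betw f UNIV {..<length ys} \<and> (\<forall>p. g p = ys ! f p))"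
proof
  assume eq: "image_mset g (mset_set UNIV) = mset ys"
  obtain xs where xs: "set xs = (UNIV :: 'n set)" "distinct xs"
    using finite_distinct_list[OF finite_class.finite_UNIV] by metis
  then have "mset_set UNIV = mset xs"
    using mset_set_set[of xs] by simp
  then have "mset (map g xs) = mset ys"
    using eq by simp
  then obtain h where h: "h permutes {..<length ys}" "permute_list h ys = map g xs"
    by (rule mset_eq_permutation)
  then have len: "length xs = length ys" by (metis length_map length_permute_list)
  have h': "bij_betw h {..<length xs} {..<length ys}"
    using permutes_imp_bij[OF h(1)] len by simp
  have b: "bij_betw ((!) xs) {..<length xs} UNIV"
    using bij_betw_nth[OF xs(2) refl] xs(1) by simp
  let ?f = "h \<circ> the_inv_into {..<length xs} ((!) xs)"
  have "bij_betw ?f UNIV {..<length ys}"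
    using bij_betw_trans[OF bij_betw_the_inv_into[OF b] h'] .
  moreover have "g p = ys ! ?f p" for p
  proof -
    let ?i = "the_inv_into {..<length xs} ((!) xs) p"
    have "?i < length xs" using bij_betw_apply[OF bij_betw_the_inv_into[OF b], of p] by simp
    moreover from this have "map g xs ! ?i = ys ! h ?i"
      unfolding h(2)[symmetric] using permute_list_nth[OF h(1)] len by simp
    moreover have "xs ! ?i = p" using f_the_inv_into_f_bij_betw[OF b, of p] by simp
    ultimately show ?thesis by simp
  qed
  ultimately show "\<exists>f. bij_betw f UNIV {..<length ys} \<and> (\<forall>p. g p = ys ! f p)" by blast
next
  assume "\<exists>f. bij_betw f UNIV {..<length ys} \<and> (\<forall>p. g p = ys ! f p)"
  then obtain f where f: "bij_betw f UNIV {..<length ys}" "\<And>p. g p = ys ! f p" by blast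
  have "image_mset g (mset_set UNIV) = image_mset ((!) ys) (image_mset f (mset_set UNIV))"
    using f(2) by (auto simp: multiset.map_comp intro!: image_mset_cong)
  also have "image_mset f (mset_set UNIV) = mset_set {..<length ys}"
    using f(1) by (metis bij_betw_def image_mset_mset_set)
  also have "\<dots> = mset [0..<length ys]"
    by (simp add: mset_upt lessThan_atLeast0)
  also have "image_mset ((!) ys) \<dots> = mset (map ((!) ys) [0..<length ys])"
    by (rule mset_map[symmetric])
  finally show "image_mset g (mset_set UNIV) = mset ys" by (simp add: map_nth)
qed

text \<open>By counting: if the sorted entry at \<open>i\<close> exceeded \<open>ys ! i\<close>, at
  most \<open>i\<close> entries of \<open>xs\<close> would be bounded by \<open>ys ! i\<close>,
  whereas the first \<open>i + 1\<close> of them all are.\<close>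

lemma sort_nth_le:
  fixes xs ys :: "'a::linorder list"
  assumes len: "length xs = length ys" and "sorted ys"
    and le: "\<And>i. i < length ys \<Longrightarrow> xs ! i \<le> ys ! i" and i: "i < length ys"
  shows "sort xs ! i \<le> ys ! i"
proof (rule ccontr)
  assume "\<not> sort xs ! i \<le> ys ! i"
  then have gt: "ys ! i < sort xs ! i" by simp
  let ?P = "\<lambda>x. x \<le> ys ! i"
  have "mset (filter ?P (sort xs)) = mset (filter ?P xs)"
    by simp
  then have "length (filter ?P (sort xs)) = length (filter ?P xs)"
    by (metis size_mset)
  then have card: "card {j. j < length xs \<and> ?P (sort xs ! j)} = card {j. j < length xs \<and> ?P (xs ! j)}"
    by (simp add: length_filter_conv_card)
  have "{j. j < length xs \<and> ?P (sort xs ! j)} \<subseteq> {..<i}"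
  proof
    fix j assume "j \<in> {j. j < length xs \<and> ?P (sort xs ! j)}"
    then have j: "j < length xs" "sort xs ! j \<le> ys ! i" by auto
    then have "sort xs ! i \<le> sort xs ! j" if "i \<le> j" using that by (intro sorted_nth_mono) auto
    with j gt show "j \<in> {..<i}" by force
  qed
  then have "card {j. j < length xs \<and> ?P (sort xs ! j)} \<le> i"
    using card_mono[of "{..<i}" "{j. j < length xs \<and> ?P (sort xs ! j)}"] by simp
  moreover have "xs ! j \<le> ys ! i" if "j \<le> i" for j
    using le[of j] sorted_nth_mono[OF \<open>sorted ys\<close> that i] that i by force
  then have "{..i} \<subseteq> {j. j < length xs \<and> ?P (xs ! j)}"
    using i len by auto
  then have "Suc i \<le> card {j. j < length xs \<and> ?P (xs ! j)}"
    using card_mono[of "{j. j < length xs \<and> ?P (xs ! j)}" "{..i}"] by simp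
  ultimately show False using card by simp
qed

text \<open>Any assignment \<open>f\<close> of bounds to coordinates may serve as witness, not only
  one that sorts \<open>a\<close>. This makes the exchange arguments below possible: a modified
  point only needs a modified assignment.\<close>

lemma parking_functions_iff:
  fixes a :: "real ^ 'n::finite"
  assumes "sorted u" and len: "length u = CARD('n)"
  shows "a \<in> parking_functions u \<longleftrightarrow>
    (\<exists>f. bij_betw f UNIV {..<CARD('n)} \<and> (\<forall>p. 0 \<le> a $ p \<and> a $ p \<le> u ! f p))"
proof -
  let ?b = "nondec_rearrangement a"
  have b: "mset ?b = image_mset (($) a) (mset_set UNIV)"
    by (simp add: nondec_rearrangement_def)
  have "size (mset ?b) = CARD('n)" unfolding b by simp
  then have lb: "length ?b = CARD('n)" by simp
  show ?thesis
  proof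
    assume a: "a \<in> parking_functions u"
    obtain f where "bij_betw f UNIV {..<length ?b}" "\<forall>p. a $ p = ?b ! f p"
      using image_mset_eq_mset_iff[THEN iffD1, OF b[symmetric]] by blast
    then show "\<exists>f. bij_betw f UNIV {..<CARD('n)} \<and> (\<forall>p. 0 \<le> a $ p \<and> a $ p \<le> u ! f p)"
      using a unfolding lb parking_functions_def
      by (intro exI[of _ f]) (auto dest: bij_betw_apply[of f UNIV])
  next
    assume "\<exists>f. bij_betw f UNIV {..<CARD('n)} \<and> (\<forall>p. 0 \<le> a $ p \<and> a $ p \<le> u ! f p)"
    then obtain f where f: "bij_betw f UNIV {..<CARD('n)}" and
      a: "\<And>p. 0 \<le> a $ p" "\<And>p. a $ p \<le> u ! f p" by blast
    let ?xs = "map (\<lambda>i. a $ inv f i) [0..<CARD('n)]"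
    have inv: "inv f (f p) = p" for p
      using f by (simp add: bij_betw_def inv_f_f)
    have "f p < CARD('n)" for p
      using bij_betw_apply[OF f, of p] by simp
    then have "image_mset (($) a) (mset_set UNIV) = mset ?xs"
      using f by (intro image_mset_eq_mset_iff[THEN iffD2] exI[of _ f]) (simp add: inv)
    then have "?b = sort ?xs"
      unfolding nondec_rearrangement_def by (metis sorted_list_of_multiset_mset)
    moreover have "a $ inv f i \<le> u ! i" if "i < CARD('n)" for i
    proof -
      have "f (inv f i) = i" using f that by (simp add: bij_betw_def f_inv_into_f)
      then show ?thesis using a(2)[of "inv f i"] by simp
    qed
    ultimately have "?b ! i \<le> u ! i" if "i < CARD('n)" for i
      using sort_nth_le[of ?xs u i] assms that by simp
    then show "a \<in> parking_functions u"
      using a unfolding parking_functions_def by simp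
  qed
qed

text \<open>Induction on the size of \<open>I\<close>: choose \<open>z\<close> at which
  \<open>a\<close> and \<open>b\<close> are both maximal, alter the permutation by one transposition
  so that it fixes \<open>z\<close> without decreasing the sum, and remove \<open>z\<close>.\<close>

lemma rearrangement_inequality:
  fixes a b :: "'i \<Rightarrow> real"
  assumes "finite I" and "p permutes I"
    and "\<And>i j. i \<in> I \<Longrightarrow> j \<in> I \<Longrightarrow> a i < a j \<Longrightarrow> b i \<le> b j"
  shows "(\<Sum>i\<in>I. a i * b (p i)) \<le> (\<Sum>i\<in>I. a i * b i)"
  using assms
proof (induction "card I" arbitrary: I p)
  case 0
  then show ?case by simp
next
  case (Suc n)
  have ne: "I \<noteq> {}" using Suc by auto
  \<comment> \<open>The hypothesis says nothing about \<open>b\<close> where \<open>a\<close> has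
    ties, so \<open>z\<close> is chosen with maximal \<open>b\<close> among the maximizers of
    \<open>a\<close>; then \<open>b\<close> is maximal at \<open>z\<close> over all of
    \<open>I\<close>.\<close>
  define J where "J = {i \<in> I. a i = Max (a ` I)}"
  have "Max (a ` I) \<in> a ` I" using ne Suc by simp
  then have J: "finite J" "J \<noteq> {}" using Suc by (auto simp: J_def)
  then have "Max (b ` J) \<in> b ` J" by simp
  then obtain z where z: "z \<in> J" "b z = Max (b ` J)" by (metis imageE)
  have zI: "z \<in> I" and az: "a i \<le> a z" if "i \<in> I" for i
    using z that Suc by (auto simp: J_def)
  have bz: "b i \<le> b z" if "i \<in> I" for i
  proof (cases "i \<in> J")
    case True then show ?thesis using z J by simp
  next
    case False
    then have "a i < a z" using az[OF that] z that by (auto simp: J_def)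
    then show ?thesis using Suc.prems(3) that zI[OF that] by blast
  qed
  have zI: "z \<in> I" using z J_def by blast
  obtain y where y: "p y = z" "y \<in> I"
    using permutes_image[OF Suc.prems(2)] zI by (metis imageE)
  define q where "q = p \<circ> Transposition.transpose z y"
  have qz: "q z = z" by (simp add: q_def y)
  have "q permutes I" unfolding q_def
    by (intro permutes_compose permutes_swap_id Suc.prems zI y)
  then have q: "q permutes (I - {z})"
    by (rule permutes_superset) (use qz in auto)
  have "(\<Sum>i\<in>I. a i * b (p i)) \<le> (\<Sum>i\<in>I. a i * b (q i))"
  proof (cases "y = z")
    case True then show ?thesis by (simp add: q_def)
  next
    case False
    have "I - {z} - {y} = I - {z, y}" by blast
    then have split: "sum F I = F z + F y + sum F (I - {z, y})" for F :: "'i \<Rightarrow> real"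
      using Suc.prems(1) zI y False sum.remove[of I z F] sum.remove[of "I - {z}" y F]
      by simp
    have "(\<Sum>i\<in>I - {z,y}. a i * b (p i)) = (\<Sum>i\<in>I - {z,y}. a i * b (q i))"
      by (intro sum.cong) (auto simp: q_def Transposition.transpose_def)
    \<comment> \<open>This product is exactly the gain of \<open>q\<close> over \<open>p\<close>, as
      only the summands at \<open>z\<close> and \<open>y\<close> change.\<close>
    moreover have "0 \<le> (a z - a y) * (b z - b (p z))"
      using az[OF y(2)] bz[of "p z"] permutes_in_image[OF Suc.prems(2)] zI by simp
    ultimately show ?thesis
      unfolding split[of "\<lambda>i. a i * b (p i)"] split[of "\<lambda>i. a i * b (q i)"]
      by (simp add: q_def y algebra_simps)
  qed
  also have "\<dots> = a z * b z + (\<Sum>i\<in>I - {z}. a i * b (q i))"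
    using sum.remove[OF Suc.prems(1) zI, of "\<lambda>i. a i * b (q i)"] qz by simp
  also have "\<dots> \<le> a z * b z + (\<Sum>i\<in>I - {z}. a i * b i)"
    using Suc.hyps(1)[of "I - {z}" q] Suc.hyps(2) Suc.prems q zI by simp
  also have "\<dots> = (\<Sum>i\<in>I. a i * b i)"
    using sum.remove[OF Suc.prems(1) zI, of "\<lambda>i. a i * b i"] by simp
  finally show ?case .
qed

section \<open>Normal cones\<close>

definition vertex_level :: "real list \<Rightarrow> nat \<Rightarrow> real ^ 'n \<Rightarrow> bool" where
  "vertex_level u z x \<longleftrightarrow> count_list u 0 \<le> z \<and> z \<le> length u \<and>
     image_mset (($) x) (mset_set UNIV) = mset (replicate z 0 @ drop z u)"

text \<open>
  The flag tells whether \<open>x\<close> has more zeros than \<open>u\<close>; only then can a zero entry of \<open>x\<close> be raised.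
\<close>

definition vertex_cone :: "bool \<Rightarrow> real ^ 'n \<Rightarrow> (real ^ 'n) set" where
  "vertex_cone b x = {w. (\<forall>p q. x $ p < x $ q \<longrightarrow> w $ p \<le> w $ q) \<and>
     (\<forall>p. 0 < x $ p \<longrightarrow> 0 \<le> w $ p) \<and> (b \<longrightarrow> (\<forall>p. x $ p = 0 \<longrightarrow> w $ p \<le> 0))}"

section \<open>Zeros of the bound and points of a given level\<close>

lemma valid_bound_decomp:
  assumes "valid_bound u"
  shows "u = replicate (count_list u 0) 0 @
    concat (map (\<lambda>t. replicate (count_list u t) t) (data_vector u))"
  using bound_of_MD_recovers[OF assms]
  by (simp add: bound_of_MD_def multiplicity_vector_def zip_map1 zip_same_conv_map o_def split_def)

lemma data_vector_simps:
  "set (data_vector u) = {x \<in> set u. 0 < x}" "sorted_wrt (<) (data_vector u)" "distinct (data_vector u)"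
  by (simp_all add: data_vector_def strict_sorted_list_of_set)

lemma drop_count_zero:
  assumes "valid_bound u"
  shows "drop (count_list u 0) u = concat (map (\<lambda>t. replicate (count_list u t) t) (data_vector u))"
  using valid_bound_decomp[OF assms] by (metis append_eq_conv_conj length_replicate)

lemma nth_eq_0_iff:
  assumes "valid_bound u" "i < length u"
  shows "u ! i = 0 \<longleftrightarrow> i < count_list u 0"
proof (cases "i < count_list u 0")
  case True
  then show ?thesis
    using valid_bound_decomp[OF assms(1)] by (metis length_replicate nth_append nth_replicate)
next
  case False
  then have "u ! i = drop (count_list u 0) u ! (i - count_list u 0)"
    using assms(2) by simp
  also have "\<dots> \<in> set (drop (count_list u 0) u)"
    using False assms(2) by (intro nth_mem) simp
  finally show ?thesis
    using False data_vector_simps(1)[of u] unfolding drop_count_zero[OF assms(1)] by auto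
qed

lemma nth_nonneg:
  assumes "valid_bound u" "i < length u"
  shows "0 \<le> u ! i"
  using assms unfolding valid_bound_def by simp

lemma count_zero_less_length:
  assumes "valid_bound u"
  shows "count_list u 0 < length u"
proof -
  obtain x where "x \<in> set u" "x \<noteq> 0" using assms by (auto simp: valid_bound_def)
  then obtain i where "i < length u" "u ! i \<noteq> 0" by (metis in_set_conv_nth)
  then show ?thesis using nth_eq_0_iff[OF assms] by fastforce
qed

text \<open>Puts vertices in the same form as \<open>parking_functions_iff\<close>, so that one
  assignment \<open>f\<close> describes both the point and the bounds on its coordinates.\<close>

lemma vertex_level_iff:
  fixes x :: "real ^ 'n::finite"
  assumes u: "valid_bound u" and len: "length u = CARD('n)"
  shows "vertex_level u z x \<longleftrightarrow> count_list u 0 \<le> z \<and> z \<le> CARD('n) \<and>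
    (\<exists>f. bij_betw f UNIV {..<CARD('n)} \<and> (\<forall>p. x $ p = (if f p < z then 0 else u ! f p)))"
proof -
  have nth: "(replicate z 0 @ drop z u) ! i = (if i < z then 0 else u ! i)"
    if "z \<le> CARD('n)" "i < CARD('n)" for i
    using that len by (simp add: nth_append)
  have "(bij_betw f UNIV {..<CARD('n)} \<and> (\<forall>p. x $ p = (replicate z 0 @ drop z u) ! f p)) \<longleftrightarrow>
      (bij_betw f UNIV {..<CARD('n)} \<and> (\<forall>p. x $ p = (if f p < z then 0 else u ! f p)))"
    if "z \<le> CARD('n)" for f
    using that nth bij_betw_apply[of f UNIV "{..<CARD('n)}"] by auto
  then have ex: "(\<exists>f. bij_betw f UNIV {..<CARD('n)} \<and> (\<forall>p. x $ p = (replicate z 0 @ drop z u) ! f p)) \<longleftrightarrow>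
      (\<exists>f. bij_betw f UNIV {..<CARD('n)} \<and> (\<forall>p. x $ p = (if f p < z then 0 else u ! f p)))"
    if "z \<le> CARD('n)"
    using that by simp
  show ?thesis
  proof (cases "z \<le> CARD('n)")
    case True
    then have "length (replicate z 0 @ drop z u) = CARD('n)" using len by simp
    then show ?thesis
      unfolding vertex_level_def image_mset_eq_mset_iff using len ex[OF True] by simp
  next
    case False
    then show ?thesis using len by (simp add: vertex_level_def)
  qed
qed

text \<open>All zeros of \<open>u\<close> sit at positions below \<open>count_list u 0\<close>,
  hence below \<open>z\<close>; an entry of \<open>u\<close> that survives in \<open>x\<close> is
  therefore positive.\<close>

lemma vertex_level_positive:
  fixes x :: "real ^ 'n::finite"
  assumes u: "valid_bound u" and len: "length u = CARD('n)"
    and z: "count_list u 0 \<le> z" and f: "bij_betw f UNIV {..<CARD('n)}"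
    and x: "\<And>p. x $ p = (if f p < z then 0 else u ! f p)"
  shows "0 < x $ p \<longleftrightarrow> z \<le> f p" "x $ p = 0 \<longleftrightarrow> f p < z"
proof -
  have "f p < length u" using bij_betw_apply[OF f, of p] len by simp
  then show "0 < x $ p \<longleftrightarrow> z \<le> f p" "x $ p = 0 \<longleftrightarrow> f p < z"
    using x[of p] z nth_eq_0_iff[OF u, of "f p"] nth_nonneg[OF u, of "f p"] by auto
qed

text \<open>The level \<open>z\<close> is thus determined by the point \<open>x\<close>; injectivity
  of the map from partitions to points rests on this.\<close>

lemma vertex_level_card_zero:
  fixes x :: "real ^ 'n::finite"
  assumes u: "valid_bound u" and len: "length u = CARD('n)" and x: "vertex_level u z x"
  shows "card {p. x $ p = 0} = z"
proof -
  obtain f where z: "count_list u 0 \<le> z" "z \<le> CARD('n)" and f: "bij_betw f UNIV {..<CARD('n)}"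
    and xf: "\<And>p. x $ p = (if f p < z then 0 else u ! f p)"
    using x[unfolded vertex_level_iff[OF u len]] by blast
  have "bij_betw f {p. x $ p = 0} {..<z}"
    unfolding vertex_level_positive(2)[OF u len z(1) f xf]
  proof (rule bij_betw_subset[OF f])
    have "i \<in> range f" if "i < z" for i
      using that z f unfolding bij_betw_def by auto
    then show "f ` {p. f p < z} = {..<z}" by (auto simp: image_iff)
  qed simp
  then show ?thesis by (simp add: bij_betw_same_card)
qed

section \<open>Supporting half-spaces at points of a given level\<close>

lemma parking_functions_permute:
  fixes x :: "real ^ 'n::finite"
  assumes "x \<in> parking_functions u" and "\<pi> permutes UNIV"
  shows "(\<chi> p. x $ \<pi> p) \<in> parking_functions u"
proof -
  have "image_mset (\<lambda>p. x $ \<pi> p) (mset_set UNIV) = image_mset (($) x) (image_mset \<pi> (mset_set UNIV))"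
    by (simp add: multiset.map_comp comp_def)
  also have "image_mset \<pi> (mset_set UNIV) = mset_set UNIV"
    using permutes_inj[OF assms(2)] permutes_surj[OF assms(2)] by (simp add: image_mset_mset_set)
  finally show ?thesis
    using assms(1) by (auto simp: parking_functions_def nondec_rearrangement_def cong: image_mset_cong)
qed

lemma vertex_level_parking:
  fixes x :: "real ^ 'n::finite"
  assumes u: "valid_bound u" and len: "length u = CARD('n)" and x: "vertex_level u z x"
  shows "x \<in> parking_functions u"
proof -
  obtain f where f: "bij_betw f UNIV {..<CARD('n)}"
    and xf: "\<And>p. x $ p = (if f p < z then 0 else u ! f p)"
    using x[unfolded vertex_level_iff[OF u len]] by blast
  have "0 \<le> x $ p \<and> x $ p \<le> u ! f p" for p
    using nth_nonneg[OF u, of "f p"] bij_betw_apply[OF f, of p] xf len by auto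
  moreover have "sorted u" using u by (simp add: valid_bound_def)
  ultimately show ?thesis using f parking_functions_iff[OF _ len] by blast
qed

text \<open>A half-space that contains \<open>S\<close> contains its convex hull, so the defining
  inequalities need testing only on \<open>S\<close>.\<close>

lemma normal_cone_convex_hull:
  "normal_cone (convex hull S) {x} = {w. \<forall>y\<in>S. w \<bullet> y \<le> w \<bullet> x}"
proof -
  have "w \<bullet> y \<le> w \<bullet> x" if "\<forall>y\<in>S. w \<bullet> y \<le> w \<bullet> x" "y \<in> convex hull S" for w y
  proof -
    have "convex hull S \<subseteq> {y. w \<bullet> y \<le> w \<bullet> x}"
      using that(1) by (intro hull_minimal) (auto simp: convex_halfspace_le)
    then show ?thesis using that(2) by blast
  qed
  then show ?thesis
    unfolding normal_cone_def using hull_inc[of _ S convex] by auto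
qed

lemma inner_axis_vec: "w \<bullet> axis p c = w $ p * (c :: real)"
  by (simp add: inner_axis)

text \<open>For necessity, \<open>w\<close> is tested against three kinds of parking functions: two
  coordinates of \<open>x\<close> exchanged, a positive one lowered to zero, a zero one raised. For
  sufficiency, \<open>w\<close> is replaced by its positive part, the coordinates of
  \<open>y\<close> by their bounds, and the rearrangement inequality compares the resulting
  sums.\<close>

lemma normal_cone_vertex:
  fixes x :: "real ^ 'n::finite"
  assumes u: "valid_bound u" and len: "length u = CARD('n)" and x: "vertex_level u z x"
  shows "normal_cone (PF u) {x} = vertex_cone (count_list u 0 < z) x"
proof -
  obtain f where z: "count_list u 0 \<le> z" "z \<le> CARD('n)" and f: "bij_betw f UNIV {..<CARD('n)}"
    and xf: "\<And>p. x $ p = (if f p < z then 0 else u ! f p)"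
    using x[unfolded vertex_level_iff[OF u len]] by blast
  note pos = vertex_level_positive[OF u len z(1) f xf]
  have so: "sorted u" using u by (simp add: valid_bound_def)
  have fl: "f p < length u" for p using bij_betw_apply[OF f, of p] len by simp
  have xge: "0 \<le> x $ p" for p using pos[of p] by linarith
  note park = parking_functions_iff[OF so len]
  have xp: "x \<in> parking_functions u" by (rule vertex_level_parking[OF u len x])
  have "w \<in> vertex_cone (count_list u 0 < z) x" if w: "\<forall>y\<in>parking_functions u. w \<bullet> y \<le> w \<bullet> x" for w
  proof -
    have "w $ p \<le> w $ q" if lt: "x $ p < x $ q" for p q
    proof -
      have "p \<noteq> q" using lt by auto
      define y where "y = (\<chi> i. x $ Transposition.transpose p q i)"
      have "y = x + axis p (x $ q - x $ p) + axis q (x $ p - x $ q)"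
        using \<open>p \<noteq> q\<close> by (auto simp: y_def vec_eq_iff axis_def Transposition.transpose_def)
      moreover have "y \<in> parking_functions u" unfolding y_def
        by (intro parking_functions_permute xp permutes_swap_id UNIV_I)
      ultimately have "w $ p * (x $ q - x $ p) + w $ q * (x $ p - x $ q) \<le> 0"
        using w by (force simp: inner_add_right inner_axis_vec)
      then have "(w $ p - w $ q) * (x $ q - x $ p) \<le> 0" by (simp add: algebra_simps)
      then show ?thesis using lt by (simp add: mult_le_0_iff)
    qed
    moreover have "0 \<le> w $ p" if "0 < x $ p" for p
    proof -
      have "x + axis p (- x $ p) \<in> parking_functions u"
        unfolding park using f nth_nonneg[OF u fl] xf
        by (intro exI[of _ f]) (auto simp: axis_def xge)
      then have "0 \<le> w $ p * x $ p"
        using w by (force simp: inner_add_right inner_axis_vec)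
      then show ?thesis using that by (simp add: zero_le_mult_iff)
    qed
    moreover have "w $ p \<le> 0" if zc: "count_list u 0 < z" and "x $ p = 0" for p
    proof -
      \<comment> \<open>Position \<open>z - 1\<close> is the last one overwritten by zero. As
        \<open>z\<close> exceeds the number of zeros of \<open>u\<close>, its entry is positive and
        gives room to raise a coordinate.\<close>
      define i where "i = z - 1"
      have i: "count_list u 0 \<le> i" "i < z" "i < length u" using zc z len by (auto simp: i_def)
      obtain q where q: "f q = i" using f i len by (metis bij_betw_def imageE lessThan_iff)
      have ui: "0 < u ! i" using nth_eq_0_iff[OF u i(3)] nth_nonneg[OF u i(3)] i(1) by linarith
      \<comment> \<open>The transposition hands position \<open>i\<close> to \<open>p\<close>. The
        coordinate \<open>q\<close> that held it is zero in \<open>x\<close>, so it tolerates any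
        bound.\<close>
      define h where "h = f \<circ> Transposition.transpose p q"
      have "bij_betw h UNIV {..<CARD('n)}" unfolding h_def
        by (intro bij_betw_trans[OF _ f] permutes_imp_bij permutes_swap_id UNIV_I)
      moreover have "0 \<le> (x + axis p (u ! i)) $ j \<and> (x + axis p (u ! i)) $ j \<le> u ! h j" for j
      proof (cases "j = p")
        case True
        then show ?thesis using that(2) ui q by (simp add: h_def)
      next
        case False
        have "x $ j = 0 \<or> x $ j = u ! h j"
          using False pos(2)[of j] xf[of j] q i(2) by (auto simp: h_def Transposition.transpose_def)
        moreover have "h j < length u" by (simp add: h_def fl)
        then have "0 \<le> u ! h j" by (rule nth_nonneg[OF u])
        ultimately show ?thesis using False by (auto simp: axis_def)
      qed
      ultimately have "x + axis p (u ! i) \<in> parking_functions u"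
        unfolding park by blast
      then have "w $ p * u ! i \<le> 0"
        using w by (force simp: inner_add_right inner_axis_vec)
      then show ?thesis using ui by (simp add: mult_le_0_iff)
    qed
    ultimately show ?thesis unfolding vertex_cone_def by simp
  qed
  moreover have "w \<bullet> y \<le> w \<bullet> x"
    if w: "w \<in> vertex_cone (count_list u 0 < z) x" and "y \<in> parking_functions u" for w y
  proof -
    have w1: "w $ p \<le> w $ q" if "x $ p < x $ q" for p q using w that by (simp add: vertex_cone_def)
    have w2: "0 \<le> w $ p" if "0 < x $ p" for p using w that by (simp add: vertex_cone_def)
    have w3: "w $ p \<le> 0" if "x $ p = 0" "count_list u 0 < z" for p
      using w that by (simp add: vertex_cone_def)
    obtain g where g: "bij_betw g UNIV {..<CARD('n)}" "\<And>p. 0 \<le> y $ p" "\<And>p. y $ p \<le> u ! g p"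
      using \<open>y \<in> parking_functions u\<close> unfolding park by blast
    define a where "a p = max 0 (w $ p)" for p
    \<comment> \<open>Since \<open>f\<close> after \<open>\<pi>\<close> is \<open>g\<close>, the
      bounds used by \<open>y\<close> become a permutation of those used by
      \<open>x\<close>.\<close>
    define \<pi> where "\<pi> = inv f \<circ> g"
    have fpi: "f (\<pi> p) = g p" for p
      using f bij_betw_apply[OF g(1), of p] unfolding \<pi>_def
      by (simp add: bij_betw_def f_inv_into_f)
    have "bij \<pi>" unfolding \<pi>_def
      by (rule bij_betw_trans[OF g(1)]) (use bij_betw_inv_into[OF f] in simp)
    then have perm: "\<pi> permutes UNIV" by (simp add: permutes_altdef)
    have "w \<bullet> y \<le> (\<Sum>p\<in>UNIV. a p * u ! f (\<pi> p))"
      unfolding inner_vec_def inner_real_def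
    proof (rule sum_mono)
      fix p
      have "w $ p * y $ p \<le> a p * y $ p" using g(2) by (intro mult_right_mono) (auto simp: a_def)
      also have "\<dots> \<le> a p * u ! f (\<pi> p)" using g(3) by (intro mult_left_mono) (auto simp: a_def fpi)
      finally show "w $ p * y $ p \<le> a p * u ! f (\<pi> p)" .
    qed
    also have "\<dots> \<le> (\<Sum>p\<in>UNIV. a p * u ! f p)"
    proof (rule rearrangement_inequality[OF _ perm])
      fix p q assume "a p < a q"
      then have lt: "w $ p < w $ q" "0 < w $ q" by (auto simp: a_def split: if_splits)
      have not: "\<not> x $ q < x $ p" using w1[of q p] lt by auto
      show "u ! f p \<le> u ! f q"
      proof (cases "x $ q = 0")
        case True
        \<comment> \<open>Positive weight at a zero coordinate is possible only without extra zeros.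
          Every zero coordinate then sits at a zero entry of \<open>u\<close>, so the two entries
          compared are both zero.\<close>
        then have "z = count_list u 0" using w3[of q] lt z(1) by force
        moreover have "x $ p = 0" using True not xge[of p] by simp
        ultimately show ?thesis
          using pos(2)[of p] nth_eq_0_iff[OF u fl] nth_nonneg[OF u fl] by metis
      next
        case False
        then have q: "z \<le> f q" using pos(2)[of q] by simp
        show ?thesis
        proof (cases "f p < z")
          case True
          then show ?thesis using q fl so by (intro sorted_nth_mono) auto
        next
          case False
          then show ?thesis using q xf[of p] xf[of q] not by simp
        qed
      qed
    qed simp
    \<comment> \<open>Equality holds termwise: at a zero coordinate either the positive part
      vanishes or the entry of \<open>u\<close> does; at a positive one \<open>w\<close> is
      nonnegative and \<open>x\<close> attains its bound.\<close>
    also have "\<dots> = w \<bullet> x" unfolding inner_vec_def inner_real_def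
    proof (rule sum.cong)
      fix p
      show "a p * u ! f p = w $ p * x $ p"
      proof (cases "x $ p = 0")
        case True
        show ?thesis
        proof (cases "count_list u 0 < z")
          case True
          then show ?thesis using w3[of p] \<open>x $ p = 0\<close> by (simp add: a_def)
        next
          case False
          then have "u ! f p = 0"
            using True pos(2)[of p] nth_eq_0_iff[OF u fl[of p]] z(1) by simp
          then show ?thesis using True by simp
        qed
      next
        case False
        then have "0 < x $ p" using xge[of p] by simp
        then show ?thesis using w2[of p] xf[of p] pos(1)[of p] by (simp add: a_def)
      qed
    qed simp
    finally show ?thesis .
  qed
  ultimately show ?thesis unfolding PF_def normal_cone_convex_hull by blast
qed

section \<open>Extreme points\<close>

text \<open>If \<open>x\<close> lay inside a segment from \<open>a\<close> to \<open>b\<close> in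
  \<open>P\<close>, every vector of the normal cone would be orthogonal to \<open>b - a\<close>.
  Differences of the given vectors yield all unit vectors, which forces
  \<open>a = b\<close>.\<close>

lemma extreme_point_if_normal_cone_full:
  fixes x :: "real ^ 'n::finite"
  assumes "x \<in> P" and w: "\<And>p. w + axis p 1 \<in> normal_cone P {x}" "w \<in> normal_cone P {x}"
  shows "x extreme_point_of P"
  unfolding extreme_point_of_def
proof (intro conjI ballI notI)
  fix a b assume ab: "a \<in> P" "b \<in> P" and "x \<in> open_segment a b"
  then obtain t where t: "0 < t" "t < 1" "x = (1 - t) *\<^sub>R a + t *\<^sub>R b" and ne: "a \<noteq> b"
    unfolding in_segment by blast
  have eq: "v \<bullet> (b - a) = 0" if "v \<in> normal_cone P {x}" for v
  proof -
    have le: "v \<bullet> a \<le> v \<bullet> x" "v \<bullet> b \<le> v \<bullet> x"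
      using that ab by (auto simp: normal_cone_def)
    have "v \<bullet> x - v \<bullet> a = t * (v \<bullet> (b - a))" "v \<bullet> x - v \<bullet> b = (t - 1) * (v \<bullet> (b - a))"
      unfolding t(3) by (simp_all add: inner_add_right inner_diff_right algebra_simps)
    then have "0 \<le> t * (v \<bullet> (b - a))" "0 \<le> (t - 1) * (v \<bullet> (b - a))"
      using le by linarith+
    then show ?thesis using t(1,2) by (auto simp: zero_le_mult_iff)
  qed
  have "(b - a) $ p = 0" for p
    using eq[OF w(1)[of p]] eq[OF w(2)]
    by (simp add: inner_add_left) (simp add: inner_commute[of "axis p 1"] inner_axis)
  then show False using ne by (simp add: vec_eq_iff)
qed (rule assms)

text \<open>It suffices to find \<open>w\<close> that satisfies all the inequalities with slack 1,
  because adding a vector with entries in the unit interval then stays in the cone.\<close>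

lemma vertex_cone_full:
  fixes x :: "real ^ 'n::finite"
  obtains w where "\<And>p. w + axis p 1 \<in> vertex_cone b x" "w \<in> vertex_cone b x"
proof -
  define r where "r p = card {q. x $ q < x $ p}" for p
  \<comment> \<open>The rank \<open>r\<close> grows by at least 1 whenever \<open>x\<close> grows.
    The shifts put \<open>w\<close> at most -1 where \<open>x\<close> is nonpositive and at least 1
    where it is positive.\<close>
  define w :: "real ^ 'n" where "w = (\<chi> p. if x $ p \<le> 0 then - 1 - real (card (UNIV :: 'n set)) + r p else 1 + r p)"
  have r: "r p + 1 \<le> r q" if "x $ p < x $ q" for p q
  proof -
    have "{i. x $ i < x $ p} \<subset> {i. x $ i < x $ q}" using that by auto
    then show ?thesis unfolding r_def 
      by (metis Suc_eq_plus1 Suc_leI finite psubset_card_mono)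
  qed
  have "r p \<le> CARD('n)" for p unfolding r_def by (rule card_mono) auto
  then have rn: "real (r p) \<le> real (CARD('n))" for p using of_nat_le_iff by blast
  have key: "w + v \<in> vertex_cone b x" if v: "\<And>p. 0 \<le> v $ p" "\<And>p. v $ p \<le> 1" for v
  proof -
    have "(w + v) $ p \<le> (w + v) $ q" if "x $ p < x $ q" for p q
    proof -
      have "real (r p) + 1 \<le> r q" using r[OF that] by linarith
      then show ?thesis using v(1)[of q] v(2)[of p] rn[of p] that by (auto simp: w_def)
    qed
    moreover have "0 \<le> (w + v) $ p" if "0 < x $ p" for p
      using v(1)[of p] that by (simp add: w_def)
    moreover have "(w + v) $ p \<le> 0" if "x $ p = 0" for p
      using v(2)[of p] rn[of p] that by (simp add: w_def)
    ultimately show ?thesis by (simp add: vertex_cone_def)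
  qed
  show thesis
  proof (rule that)
    show "w \<in> vertex_cone b x" using key[of 0] by simp
    show "w + axis p 1 \<in> vertex_cone b x" for p by (rule key) (auto simp: axis_def)
  qed
qed

lemma not_extreme_point_perturb:
  fixes x :: "'a::real_vector"
  assumes "x + e \<in> P" "x - e \<in> P" "e \<noteq> 0"
  shows "\<not> x extreme_point_of P"
proof -
  have "x = (1 - 1/2) *\<^sub>R (x + e) + (1/2) *\<^sub>R (x - e)"
  proof -
    have "(1/2) *\<^sub>R (x + e) + (1/2) *\<^sub>R (x - e) = (1/2) *\<^sub>R (x + x)"
      unfolding scaleR_add_right[symmetric] by simp
    then show ?thesis by (simp only: scaleR_half_double) simp
  qed
  moreover have "x + e \<noteq> x - e"
  proof
    assume "x + e = x - e"
    then have "2 *\<^sub>R e = 0" by (simp add: scaleR_2 diff_conv_add_uminus eq_neg_iff_add_eq_0 del: add_uminus_conv_diff)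
    then show False using assms(3) by simp
  qed
  ultimately have "x \<in> open_segment (x + e) (x - e)"
    unfolding in_segment by (intro conjI exI[of _ "1/2"]) simp_all
  then show ?thesis using assms unfolding extreme_point_of_def by blast
qed

text \<open>Sorting \<open>A\<close> and \<open>B\<close> separately and concatenating gives a
  sorted list with the elements of \<open>u\<close>, hence \<open>u\<close> itself.\<close>

lemma sorted_split:
  fixes u :: "'a::linorder list"
  assumes "sorted u" "mset u = A + B" "\<And>a b. a \<in># A \<Longrightarrow> b \<in># B \<Longrightarrow> a \<le> b"
  shows "mset (drop (size A) u) = B"
proof -
  let ?v = "sorted_list_of_multiset A @ sorted_list_of_multiset B"
  have "sorted ?v" using assms(3) by (simp add: sorted_append)
  moreover have "mset ?v = mset u" using assms(2) by simp
  ultimately have "u = ?v"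
    using assms(1) by (metis properties_for_sort)
  moreover have "length (sorted_list_of_multiset A) = size A"
    by (metis mset_sorted_list_of_multiset size_mset)
  ultimately have "drop (size A) u = sorted_list_of_multiset B"
    by (metis append_eq_conv_conj)
  then show ?thesis by simp
qed

text \<open>At an extreme point no single coordinate can move both ways within the parking
  functions. Hence nonzero coordinates attain their bounds, and zero coordinates occupy the smallest
  entries of \<open>u\<close>; \<open>z\<close> is the number of zero coordinates.\<close>

lemma extreme_point_PF_imp_vertex:
  fixes x :: "real ^ 'n::finite"
  assumes u: "valid_bound u" and len: "length u = CARD('n)" and x: "x extreme_point_of PF u"
  shows "\<exists>z. vertex_level u z x"
proof -
  have so: "sorted u" using u by (simp add: valid_bound_def)
  note park = parking_functions_iff[OF so len]
  have "x \<in> parking_functions u"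
    using x unfolding PF_def by (rule extreme_point_of_convex_hull)
  then obtain f where f: "bij_betw f UNIV {..<CARD('n)}"
    and x0: "\<And>p. 0 \<le> x $ p" and xu: "\<And>p. x $ p \<le> u ! f p" unfolding park by blast
  have rigid: False
    if "x + axis p e \<in> parking_functions u" "x - axis p e \<in> parking_functions u" "0 < e" for p e
    using that not_extreme_point_perturb[of x "axis p e" "PF u"] x
    by (auto simp: PF_def hull_inc axis_eq_0_iff)
  have val: "x $ p = u ! f p" if "x $ p \<noteq> 0" for p
  proof (rule ccontr)
    assume "x $ p \<noteq> u ! f p"
    \<comment> \<open>The distance to the nearer end of the interval from 0 to
      \<open>u ! f p\<close>.\<close>
    define e where "e = min (x $ p) (u ! f p - x $ p)"
    have e: "0 < e" "e \<le> x $ p" "e \<le> u ! f p - x $ p"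
      using that x0[of p] xu[of p] \<open>x $ p \<noteq> u ! f p\<close> by (auto simp: e_def)
    show False
    proof (rule rigid[OF _ _ e(1)])
      show "x + axis p e \<in> parking_functions u"
        unfolding park using e x0 xu
        by (intro exI[of _ f] conjI f allI) (auto simp: axis_def add_nonneg_nonneg)
      show "x - axis p e \<in> parking_functions u"
        unfolding park using e x0 xu
        by (intro exI[of _ f] conjI f allI) (auto simp: axis_def intro: order_trans[OF _ xu])
    qed
  qed
  have order: "u ! f p \<le> u ! f q" if zero: "x $ p = 0" and q: "x $ q \<noteq> 0" for p q
  proof (rule ccontr)
    assume lt: "\<not> u ! f p \<le> u ! f q"
    have ne: "p \<noteq> q" using that by auto
    have vq: "x $ q = u ! f q" using val[OF q] .
    have posq: "0 < u ! f q" using q x0[of q] vq by simp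
    \<comment> \<open>Under \<open>g\<close> the coordinate \<open>q\<close> receives the larger
      bound \<open>u ! f p\<close>, while \<open>p\<close>, being zero, accepts the smaller one.
      Raising \<open>q\<close> uses \<open>g\<close>, lowering it uses \<open>f\<close>.\<close>
    define g where "g = f \<circ> Transposition.transpose p q"
    have g: "bij_betw g UNIV {..<CARD('n)}" unfolding g_def
      by (intro bij_betw_trans[OF _ f] permutes_imp_bij permutes_swap_id UNIV_I)
    define e where "e = min (x $ q) (u ! f p - u ! f q)"
    have e: "0 < e" "e \<le> x $ q" "e \<le> u ! f p - u ! f q"
      using q x0[of q] lt by (auto simp: e_def)
    have gs: "g p = f q" "g q = f p" "\<And>i. i \<noteq> p \<Longrightarrow> i \<noteq> q \<Longrightarrow> g i = f i"
      by (auto simp: g_def Transposition.transpose_def)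
    show False
    proof (rule rigid[OF _ _ e(1)])
      have "0 \<le> (x + axis q e) $ i \<and> (x + axis q e) $ i \<le> u ! g i" for i
        using e x0[of i] xu[of i] zero ne vq posq gs
        by (cases "i = q"; cases "i = p") (auto simp: axis_def)
      then show "x + axis q e \<in> parking_functions u"
        unfolding park using g by blast
      have "0 \<le> (x - axis q e) $ i \<and> (x - axis q e) $ i \<le> u ! f i" for i
        using e x0[of i] xu[of i] by (cases "i = q") (auto simp: axis_def)
      then show "x - axis q e \<in> parking_functions u"
        unfolding park using f by blast
    qed
  qed
  define Z where "Z = {p. x $ p = 0}"
  define A where "A = image_mset (\<lambda>p. u ! f p) (mset_set Z)"
  define B where "B = image_mset (\<lambda>p. u ! f p) (mset_set (- Z))"
  have un: "mset_set (UNIV :: 'n set) = mset_set Z + mset_set (- Z)"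
    using mset_set_Union[of Z "- Z"] by simp
  have "mset u = image_mset (\<lambda>p. u ! f p) (mset_set UNIV)"
    using image_mset_eq_mset_iff[of "\<lambda>p. u ! f p" u] f len by auto
  then have AB: "mset u = A + B" unfolding A_def B_def un by simp
  have sA: "size A = card Z" by (simp add: A_def)
  have "mset (drop (size A) u) = B"
    by (rule sorted_split[OF so AB]) (auto simp: A_def B_def Z_def intro: order)
  moreover have "image_mset (($) x) (mset_set Z) = replicate_mset (card Z) 0"
  proof -
    have "image_mset (($) x) (mset_set Z) = image_mset (\<lambda>_. 0) (mset_set Z)"
      by (rule image_mset_cong) (simp add: Z_def)
    then show ?thesis by (simp add: image_mset_const_eq)
  qed
  moreover have "image_mset (($) x) (mset_set (- Z)) = B"
    unfolding B_def using val by (intro image_mset_cong) (simp add: Z_def)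
  ultimately have "image_mset (($) x) (mset_set UNIV) = mset (replicate (card Z) 0 @ drop (card Z) u)"
    unfolding un by (simp add: sA)
  \<comment> \<open>The entries in \<open>B\<close> are nonzero coordinates of \<open>x\<close>, so
    every zero of \<open>u\<close> is counted in \<open>A\<close>.\<close>
  moreover have "count_list u 0 \<le> card Z"
  proof -
    have "0 \<notin># B" using val by (auto simp: B_def Z_def)
    then have "count (mset u) 0 = count A 0" unfolding AB by (simp add: count_eq_zero_iff)
    also have "\<dots> \<le> size A" by (rule count_le_size)
    finally show ?thesis by (simp add: sA count_mset)
  qed
  moreover have "card Z \<le> length u" unfolding len by (rule card_mono) auto
  ultimately show ?thesis unfolding vertex_level_def by blast
qed

lemma extreme_point_PF_iff:
  fixes x :: "real ^ 'n::finite"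
  assumes "valid_bound u" and "length u = CARD('n)"
  shows "x extreme_point_of PF u \<longleftrightarrow> (\<exists>z. vertex_level u z x)"
proof
  assume "\<exists>z. vertex_level u z x"
  then obtain z where z: "vertex_level u z x" ..
  obtain w where "\<And>p. w + axis p 1 \<in> vertex_cone (count_list u 0 < z) x"
      "w \<in> vertex_cone (count_list u 0 < z) x"
    using vertex_cone_full by blast
  then show "x extreme_point_of PF u"
    using vertex_level_parking[OF assms z]
    unfolding normal_cone_vertex[OF assms z, symmetric]
    by (intro extreme_point_if_normal_cone_full[of x _ w]) (auto simp: PF_def hull_inc)
qed (rule extreme_point_PF_imp_vertex[OF assms])

section \<open>Types\<close>

text \<open>The distinct positive values left in \<open>u\<close> after its first \<open>z\<close>
  entries, in increasing order. Filtering the data vector, rather than sorting afresh, prepares the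
  proof that they form a suffix of it.\<close>

definition levels :: "real list \<Rightarrow> nat \<Rightarrow> real list" where
  "levels u z = filter (\<lambda>t. t \<in> set (drop z u)) (data_vector u)"

text \<open>A uniform description of the elements of \<open>Omega\<close>, indexed by the number
  \<open>z\<close> of zeros instead of the offset \<open>i\<close> from the number of zeros of
  \<open>u\<close>; counting in \<open>drop z u\<close> replaces the search for
  \<open>g\<close>.\<close>

definition canonical_type :: "real list \<Rightarrow> nat \<Rightarrow> type_entry list" where
  "canonical_type u z =
     (if z = count_list u 0 \<and> 0 < z then [Plain z, Plain 0] else [Plain z, Circ 0]) @
     map (\<lambda>t. Plain (count_list (drop z u) t)) (levels u z)"

section \<open>Runs of equal entries and partial sums of multiplicities\<close>

lemma count_list_replicate: "count_list (replicate k x) y = (if x = y then k else 0)"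
  by (induction k) auto

lemma drop_concat_replicate:
  assumes "sum_list (map c xs) \<le> i" "i < sum_list (map c xs) + c t"
  shows "drop i (concat (map (\<lambda>t. replicate (c t) t) (xs @ t # ys))) =
    replicate (sum_list (map c xs) + c t - i) t @ concat (map (\<lambda>t. replicate (c t) t) ys)"
proof -
  have "length (concat (map (\<lambda>t. replicate (c t) t) xs)) = sum_list (map c xs)"
    by (simp add: length_concat comp_def)
  then show ?thesis using assms by simp
qed

lemma count_data_vector_pos: "t \<in> set (data_vector u) \<Longrightarrow> 0 < count_list u t"
  by (metis count_list_0_iff data_vector_simps(1) gr0I mem_Collect_eq)

lemma multiplicity_partial_sum:
  assumes "g \<le> length (data_vector u)"
  shows "(\<Sum>j=1..g. multiplicity_vector u ! j) = sum_list (map (count_list u) (take g (data_vector u)))"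
  using assms
proof (induction g)
  case (Suc g)
  then have "take (Suc g) (data_vector u) = take g (data_vector u) @ [data_vector u ! g]"
    by (simp add: take_Suc_conv_app_nth)
  moreover have "multiplicity_vector u ! Suc g = count_list u (data_vector u ! g)"
    using Suc by (simp add: multiplicity_vector_def)
  ultimately show ?case using Suc by simp
qed simp

lemma length_multiplicity_vector: "length (multiplicity_vector u) = Suc (length (data_vector u))"
  by (simp add: multiplicity_vector_def)

lemma magnitude_multiplicity_vector:
  assumes "valid_bound u"
  shows "magnitude (multiplicity_vector u) = length u"
  using length_bound_of_MD[OF length_multiplicity_vector[of u]] bound_of_MD_recovers[OF assms] by simp

lemma multiplicity_sum:
  assumes "valid_bound u"
  shows "(\<Sum>j=1..length (data_vector u). multiplicity_vector u ! j) = length u - count_list u 0"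
proof -
  have "(\<Sum>j=1..length (data_vector u). multiplicity_vector u ! j) =
      sum_list (map (count_list u) (data_vector u))"
    using multiplicity_partial_sum[of "length (data_vector u)" u] by simp
  then show ?thesis
    using magnitude_multiplicity_vector[OF assms] by (simp add: magnitude_def multiplicity_vector_def)
qed

text \<open>Discarding the zeros and the next \<open>i\<close> entries of \<open>u\<close> cuts its
  runs of equal values at one place: earlier runs disappear, the run of the value with index
  \<open>g\<close> may be shortened, and later runs stay intact. For the same reason the surviving
  values form a suffix of \<open>d\<close>.\<close>

lemma Omega_entry_eq_canonical_type:
  assumes u: "valid_bound u" and i: "count_list u 0 + i \<le> length u"
  defines "z \<equiv> count_list u 0 + i" and "d \<equiv> data_vector u"
  shows "Omega_entry (multiplicity_vector u) i = canonical_type u z \<and> (\<exists>k. levels u z = drop k d)"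
proof -
  define c where "c = count_list u"
  let ?m = "multiplicity_vector u"
  have m: "?m = c 0 # map c d" by (simp add: multiplicity_vector_def c_def d_def)
  define r where "r = (\<Sum>j=1..length d. ?m ! j)"
  have r: "r = length u - c 0" unfolding r_def d_def c_def by (rule multiplicity_sum[OF u])
  have rs: "r = sum_list (map c d)"
    unfolding r_def d_def c_def using multiplicity_partial_sum[of "length (data_vector u)" u] by simp
  have c0: "c 0 < length u" unfolding c_def by (rule count_zero_less_length[OF u])
  have dropz: "drop z u = drop i (concat (map (\<lambda>t. replicate (c t) t) d))"
    using drop_count_zero[OF u] unfolding z_def c_def d_def by (metis add.commute drop_drop)
  have dist: "distinct d" unfolding d_def by (rule data_vector_simps)
  have cpos: "0 < c t" if "t \<in> set d" for t
    using count_data_vector_pos that unfolding c_def d_def by blast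
  have z0: "z = c 0 + i" by (simp add: z_def c_def)
  have Om: "Omega_entry ?m i =
      (if i = 0 then (if 0 < c 0 then [Plain (c 0), Plain 0] else [Plain 0, Circ 0]) @ map Plain (map c d)
       else if i < r then
        (let g = (THE g. 1 \<le> g \<and> g \<le> length d \<and> (\<Sum>j=1..g-1. ?m ! j) \<le> i \<and> i < (\<Sum>j=1..g. ?m ! j)) in
         [Plain (c 0 + i), Circ 0, Plain ((\<Sum>j=1..g. ?m ! j) - i)] @ map Plain (drop (g + 1) ?m))
       else [Plain (length u), Circ 0])"
    unfolding Omega_entry_def r_def Let_def magnitude_multiplicity_vector[OF u]
    by (simp add: m)
  consider "i = 0" | "0 < i" "i < r" | "i = r" "0 < i" 
    using r i unfolding c_def by linarith
  then show ?thesis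
  proof cases
    case 1
    have du: "drop z u = concat (map (\<lambda>t. replicate (c t) t) d)" using dropz 1 by simp
    have lev: "levels u z = d"
      unfolding levels_def du d_def[symmetric] using cpos by (auto simp: filter_id_conv)
    have "count_list (drop z u) t = c t" if "t \<in> set d" for t
      unfolding du count_concat_replicate[OF dist] using that by simp
    then have "Omega_entry ?m i = canonical_type u z"
      unfolding Om canonical_type_def lev c_def[symmetric] using 1 z0 by simp
    then show ?thesis using lev by (metis drop0)
  next
    case 2
    define S where "S g = (\<Sum>j=1..g. ?m ! j)" for g
    have ex: "\<exists>g. i < S g" using 2 unfolding r_def S_def by blast
    \<comment> \<open>The least index whose partial sum exceeds \<open>i\<close> meets the
      description in \<open>Omega_entry\<close>; monotonicity of \<open>S\<close> makes it the only
      one.\<close>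
    define g where "g = (LEAST g. i < S g)"
    have g1: "i < S g" unfolding g_def using ex by (rule LeastI_ex)
    have g2: "S h \<le> i" if "h < g" for h
      using not_less_Least[of h "\<lambda>g. i < S g"] that unfolding g_def by simp
    have Smono: "S a \<le> S b" if "a \<le> b" for a b
      unfolding S_def using that by (intro sum_mono2) auto
    have gl: "g \<le> length d" unfolding g_def using 2 unfolding r_def S_def by (intro Least_le)
    have "S 0 = 0" by (simp add: S_def)
    then have gpos: "0 < g" using g1 by (cases g) auto
    have the: "(THE g. 1 \<le> g \<and> g \<le> length d \<and> S (g - 1) \<le> i \<and> i < S g) = g"
    proof (rule the_equality)
      fix h assume h: "1 \<le> h \<and> h \<le> length d \<and> S (h - 1) \<le> i \<and> i < S h"
      have "\<not> h < g" using h g2 by fastforce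
      moreover have "\<not> g < h" using Smono[of g "h - 1"] h g1 by fastforce
      ultimately show "h = g" by simp
    qed (use gpos gl g1 g2 in auto)
    \<comment> \<open>The list \<open>d\<close> starts with the value of index 1, so the value of
      index \<open>g\<close> is at position \<open>g - 1\<close>. Of its run \<open>S g - i\<close>
      copies remain, at least one.\<close>
    define xs t ys where "xs = take (g - 1) d" and "t = d ! (g - 1)" and "ys = drop g d"
    have d_eq: "d = xs @ t # ys"
      unfolding xs_def t_def ys_def using gpos gl id_take_nth_drop[of "g - 1" d] by simp
    have Sx: "S (g - 1) = sum_list (map c xs)"
      using multiplicity_partial_sum[of "g - 1" u] gl unfolding S_def xs_def c_def d_def by simp
    have "take g d = xs @ [t]"
      unfolding xs_def t_def using gpos gl take_Suc_conv_app_nth[of "g - 1" d] by simp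
    then have St: "S g = sum_list (map c xs) + c t"
      using multiplicity_partial_sum[of g u] gl unfolding S_def c_def d_def by simp
    have du: "drop z u = replicate (S g - i) t @ concat (map (\<lambda>t. replicate (c t) t) ys)"
      unfolding dropz d_eq St using g1 g2[of "g - 1"] gpos Sx St by (intro drop_concat_replicate) auto
    have dd: "distinct ys" "t \<notin> set xs" "t \<notin> set ys" "set xs \<inter> set ys = {}"
      using dist unfolding d_eq by auto
    have yp: "0 < c s" if "s \<in> set ys" for s using cpos that by (simp add: d_eq)
    have sd: "set (drop z u) = insert t (set ys)"
      unfolding du using g1 yp by auto
    have lev: "levels u z = t # ys"
      unfolding levels_def d_def[symmetric] sd unfolding d_eq using dd
      by (auto simp: filter_empty_conv filter_id_conv)
    have cnt: "count_list (drop z u) s = (if s = t then S g - i else c s)" if "s \<in> set (t # ys)" for s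
      unfolding du using dd that
      by (auto simp: count_list_append count_list_replicate count_concat_replicate)
    have "drop (g + 1) ?m = map c ys" by (simp add: m ys_def drop_map)
    then have "Omega_entry ?m i = [Plain (c 0 + i), Circ 0, Plain (S g - i)] @ map Plain (map c ys)"
      unfolding Om S_def[symmetric] the Let_def using 2 by simp
    also have "\<dots> = canonical_type u z"
      unfolding canonical_type_def lev c_def[symmetric] using 2 z0 cnt dd by auto
    finally have "Omega_entry ?m i = canonical_type u z" .
    moreover have "levels u z = drop (g - 1) d"
      unfolding lev ys_def t_def using gpos gl Cons_nth_drop_Suc[of "g - 1" d] by simp
    ultimately show ?thesis by blast
  next
    case 3
    have zl: "z = length u" using 3 r z0 c0 by simp
    then have "levels u z = []" by (simp add: levels_def)
    then have "Omega_entry ?m i = canonical_type u z" "levels u z = drop (length d) d"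
      unfolding Om canonical_type_def c_def[symmetric] using 3 zl z0 by simp_all
    then show ?thesis by blast
  qed
qed

lemma Omega_multiplicity_vector:
  assumes u: "valid_bound u"
  shows "Omega (multiplicity_vector u) = canonical_type u ` {count_list u 0..length u}"
proof -
  let ?c = "count_list u 0"
  have "Omega (multiplicity_vector u) = Omega_entry (multiplicity_vector u) ` {0..length u - ?c}"
    unfolding Omega_def using multiplicity_sum[OF u] by (simp add: length_multiplicity_vector)
  also have "\<dots> = (\<lambda>i. canonical_type u (?c + i)) ` {0..length u - ?c}"
    using Omega_entry_eq_canonical_type[OF u] count_zero_less_length[OF u] by (intro image_cong) auto
  also have "\<dots> = canonical_type u ` ((+) ?c ` {0..length u - ?c})"
    by (simp add: image_image del: image_add_atLeastAtMost image_add_atLeastAtMost')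
  also have "(+) ?c ` {0..length u - ?c} = {?c..length u}"
    using count_zero_less_length[OF u] by (simp add: image_add_atLeastAtMost)
  finally show ?thesis .
qed

text \<open>A suffix is determined by its length. In this form the offset agrees with the index
  shift in \<open>sbp_point\<close>, whose \<open>k\<close> will be the number of levels.\<close>

lemma levels_eq_drop:
  assumes "valid_bound u" "count_list u 0 \<le> z" "z \<le> length u"
  shows "levels u z = drop (length (data_vector u) - length (levels u z)) (data_vector u)"
proof -
  obtain k where "levels u z = drop k (data_vector u)"
    using Omega_entry_eq_canonical_type[OF assms(1), of "z - count_list u 0"] assms by auto
  then show ?thesis by (cases "k \<le> length (data_vector u)") auto
qed

section \<open>Level partitions\<close>

text \<open>The inverse of the map to points. No block needs to be homogeneous, since
  \<open>B_0\<close> has at most one element and the types in question carry no star.\<close>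

definition level_partition :: "real list \<Rightarrow> nat \<Rightarrow> real ^ 'n \<Rightarrow> 'n blocks" where
  "level_partition u z x =
     (if z = count_list u 0 \<and> 0 < z
      then [(insert None (Some ` {p. x $ p = 0}), Nonhomogeneous), ({}, Nonhomogeneous)]
      else [(Some ` {p. x $ p = 0}, Nonhomogeneous), ({None}, Nonhomogeneous)]) @
     map (\<lambda>t. (Some ` {p. x $ p = t}, Nonhomogeneous)) (levels u z)"

lemma set_drop_positive:
  assumes "valid_bound u" "count_list u 0 \<le> z" "t \<in> set (drop z u)"
  shows "0 < t"
proof -
  obtain i where "i < length u - z" "t = u ! (z + i)"
    using assms(3) by (auto simp: in_set_conv_nth)
  then show ?thesis
    using nth_eq_0_iff[OF assms(1), of "z + i"] nth_nonneg[OF assms(1), of "z + i"] assms(2) by fastforce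
qed

lemma set_levels:
  assumes "valid_bound u" "count_list u 0 \<le> z"
  shows "set (levels u z) = set (drop z u)"
  using set_drop_positive[OF assms] set_drop_subset[of z u]
  by (auto simp: levels_def data_vector_simps)

lemma sorted_levels: "sorted_wrt (<) (levels u z)"
  unfolding levels_def by (intro sorted_wrt_filter data_vector_simps)

lemma count_image_mset_UNIV:
  "count (image_mset g (mset_set (UNIV :: 'n::finite set))) t = card {p. g p = t}"
proof -
  have "g -` {t} = {p. g p = t}" by auto
  then show ?thesis by (simp add: count_image_mset)
qed

text \<open>Here \<open>rk q\<close> is the list position of the block containing \<open>q\<close>;
  without homogeneous blocks, distinct elements of one block are incomparable.\<close>

lemma sbp_le_rank:
  assumes "\<And>j. j < length B \<Longrightarrow> block B j = {q. rk q = j}" "\<And>q. rk q < length B"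
    and "\<And>j. j < length B \<Longrightarrow> \<not> homogeneous B j"
  shows "sbp_le B p q \<longleftrightarrow> p = q \<or> rk p < rk q"
proof -
  have "(\<exists>i j. i < j \<and> j < length B \<and> p \<in> block B i \<and> q \<in> block B j) \<longleftrightarrow> rk p < rk q"
  proof
    assume "\<exists>i j. i < j \<and> j < length B \<and> p \<in> block B i \<and> q \<in> block B j"
    then obtain i j where "i < j" "j < length B" "p \<in> block B i" "q \<in> block B j" by blast
    then show "rk p < rk q" using assms(1)[of i] assms(1)[of j] by simp
  next
    assume "rk p < rk q"
    then show "\<exists>i j. i < j \<and> j < length B \<and> p \<in> block B i \<and> q \<in> block B j"
      using assms(1)[OF assms(2)] assms(2) by (intro exI[of _ "rk p"] exI[of _ "rk q"]) simp
  qed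
  then show ?thesis unfolding sbp_le_def using assms(3) by blast
qed

text \<open>List position \<open>r\<close> holds the block with index \<open>r - 1\<close>. Since
  \<open>D\<close> is the suffix of \<open>d\<close> of length \<open>k\<close>, the entry of
  \<open>d\<close> selected by \<open>sbp_point\<close> is the one at position \<open>r - 2\<close>
  of \<open>D\<close>.\<close>

lemma sbp_point_rank:
  fixes rk :: "'n::finite option \<Rightarrow> nat"
  assumes block: "\<And>j. j < length B \<Longrightarrow> block B j = {q. rk q = j}"
    and rk: "\<And>q. rk q < length B" "rk (Some p) \<noteq> 1"
    and B: "length B = length D + 2" and D: "D = drop (length d - length D) d"
  shows "sbp_point d B $ p = (if rk (Some p) = 0 then 0 else D ! (rk (Some p) - 2))"
proof (cases "rk (Some p) = 0")
  case True
  then show ?thesis using B by (simp add: sbp_point_def block)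
next
  case False
  then have r2: "2 \<le> rk (Some p)" using rk(2) by simp
  have "(THE j. 1 \<le> j \<and> j \<le> length D \<and> Some p \<in> block B (j + 1)) = rk (Some p) - 1"
    by (rule the_equality) (use r2 rk(1)[of "Some p"] B block in auto)
  moreover have "D ! (rk (Some p) - 2) = d ! (length d - length D + (rk (Some p) - 2))"
  proof -
    have "length D \<le> length d" by (subst D) simp
    then show ?thesis by (subst D) simp
  qed
  moreover have "length d - length D + (rk (Some p) - 1) - 1 = length d - length D + (rk (Some p) - 2)"
    using r2 by simp
  ultimately show ?thesis
    using False B unfolding sbp_point_def by (simp add: block)
qed

lemma vertex_level_count:
  fixes x :: "real ^ 'n::finite"
  assumes "vertex_level u z x"
  shows "card {p. x $ p = t} = count_list (replicate z 0 @ drop z u) t"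
  using assms unfolding vertex_level_def
  by (metis count_image_mset_UNIV count_mset)

text \<open>Everything is read off a rank function. Comparing ranks of two coordinates amounts to
  comparing their values in \<open>x\<close>, while the index 0 ranks either with the zeros or
  strictly between the zeros and the positive coordinates.\<close>

lemma level_partition_properties:
  fixes x :: "real ^ 'n::finite"
  assumes u: "valid_bound u" and len: "length u = CARD('n)" and x: "vertex_level u z x"
  defines "B \<equiv> level_partition u z x"
  shows "skewed_binary_partition B" "sbp_type B = canonical_type u z"
    "sbp_point (data_vector u) B = x"
    "sliced_preorder_cone B = vertex_cone (count_list u 0 < z) x"
proof -
  define D where "D = levels u z"
  define at0 where "at0 \<longleftrightarrow> z = count_list u 0 \<and> 0 < z"
  have z: "count_list u 0 \<le> z" "z \<le> length u" using x by (auto simp: vertex_level_def)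
  have D: "D = drop (length (data_vector u) - length D) (data_vector u)"
    unfolding D_def by (rule levels_eq_drop[OF u z])
  have Dset: "set D = set (drop z u)" unfolding D_def by (rule set_levels[OF u z(1)])
  have Dpos: "0 < t" if "t \<in> set D" for t
    using set_drop_positive[OF u z(1)] that Dset by blast
  have Dnth: "D ! i < D ! j \<longleftrightarrow> i < j" "D ! i = D ! j \<longleftrightarrow> i = j"
    if "i < length D" "j < length D" for i j
    using sorted_levels[of u z] that unfolding D_def[symmetric] sorted_wrt_iff_nth_less
    by (metis less_asym' less_irrefl linorder_neqE_nat)+
  have "range (($) x) = set (replicate z 0 @ drop z u)"
    using x unfolding vertex_level_def by (metis finite finite_set_mset_mset_set set_image_mset set_mset_mset)
  then have ran: "range (($) x) = (if 0 < z then {0} else {}) \<union> set D" by (simp add: Dset)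
  have xge: "0 \<le> x $ p" for p
    using ran Dpos[of "x $ p"] rangeI[of "($) x" p] by (auto split: if_splits intro: less_imp_le)
  have "\<exists>j<length D. D ! j = x $ p" if "x $ p \<noteq> 0" for p
    using ran that rangeI[of "($) x" p] by (auto simp: in_set_conv_nth split: if_splits)
  then obtain ix where ix: "\<And>p. x $ p \<noteq> 0 \<Longrightarrow> ix p < length D"
      "\<And>p. x $ p \<noteq> 0 \<Longrightarrow> D ! ix p = x $ p"
    by metis
  define rk where "rk q = (case q of None \<Rightarrow> if at0 then 0 else 1
    | Some p \<Rightarrow> if x $ p = 0 then 0 else ix p + 2)" for q
  have rk_simps: "rk None = (if at0 then 0 else 1)" "rk (Some p) = (if x $ p = 0 then 0 else ix p + 2)" for p
    by (simp_all add: rk_def)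
  have lenB: "length B = length D + 2"
    by (simp add: B_def level_partition_def D_def)
  have nth: "B ! 0 = (if at0 then (insert None (Some ` {p. x $ p = 0}), Nonhomogeneous)
      else (Some ` {p. x $ p = 0}, Nonhomogeneous))"
    "B ! 1 = (if at0 then ({}, Nonhomogeneous) else ({None}, Nonhomogeneous))"
    "\<And>j. j < length D \<Longrightarrow> B ! (j + 2) = (Some ` {p. x $ p = D ! j}, Nonhomogeneous)"
    unfolding B_def level_partition_def at0_def[symmetric] D_def[symmetric]
    by (simp_all add: nth_append)
  have cases_j: "j = 0 \<or> j = 1 \<or> (\<exists>i<length D. j = i + 2)" if "j < length B" for j
  proof -
    have "j = 0 \<or> j = 1 \<or> j = (j - 2) + 2 \<and> j - 2 < length D" using that lenB by linarith
    then show ?thesis by blast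
  qed
  have nonhom: "\<not> homogeneous B j" if "j < length B" for j
    using cases_j[OF that] nth by (auto simp: homogeneous_def split: if_splits)
  have rklt: "rk q < length B" for q
    using ix(1) by (cases q) (auto simp: rk_simps lenB)
  have val: "x $ p = D ! i \<longleftrightarrow> x $ p \<noteq> 0 \<and> ix p = i" if "i < length D" for i p
    using that Dnth(2)[of "ix p" i] ix[of p] Dpos[OF nth_mem[OF that]] by (cases "x $ p = 0") auto
  have block0: "block B 0 = {q. rk q = 0}"
  proof (rule set_eqI)
    fix q show "q \<in> block B 0 \<longleftrightarrow> q \<in> {q. rk q = 0}"
      by (cases q) (auto simp: block_def nth rk_simps)
  qed
  have b1: "block B 1 = (if at0 then {} else {None})"
    unfolding block_def nth by simp
  have block1: "block B 1 = {q. rk q = 1}"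
  proof (rule set_eqI)
    fix q show "q \<in> block B 1 \<longleftrightarrow> q \<in> {q. rk q = 1}"
      unfolding b1 by (cases q) (auto simp: rk_simps)
  qed
  have b2: "block B (i + 2) = Some ` {p. x $ p = D ! i}" if "i < length D" for i
    unfolding block_def nth(3)[OF that] by simp
  have block2: "block B (i + 2) = {q. rk q = i + 2}" if "i < length D" for i
  proof (rule set_eqI)
    fix q show "q \<in> block B (i + 2) \<longleftrightarrow> q \<in> {q. rk q = i + 2}"
      unfolding b2[OF that] using val[OF that] by (cases q) (auto simp: rk_simps)
  qed
  have block: "block B j = {q. rk q = j}" if "j < length B" for j
    using cases_j[OF that] block0 block1 block2 by (elim disjE exE conjE) simp_all
  note count = vertex_level_count[OF x]
  have card0: "card {p. x $ p = 0} = z" by (rule vertex_level_card_zero[OF u len x])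
  have cardD: "card {p. x $ p = t} = count_list (drop z u) t" if "t \<in> set D" for t
    using count[of t] Dpos[OF that] by (simp add: count_list_append count_list_replicate)
  have b0: "block B 0 = (if at0 then insert None (Some ` {p. x $ p = 0}) else Some ` {p. x $ p = 0})"
    by (simp add: block_def nth)
  have cb0: "card (block B 0) = (if at0 then Suc z else z)"
    unfolding b0 by (simp add: card_image card0 card_insert_if image_iff)

  show "sbp_type B = canonical_type u z"
  proof -
    have "map (\<lambda>i. if homogeneous B i then Star (card (block B i)) else Plain (card (block B i)))
        [2..<length B] = map (\<lambda>t. Plain (count_list (drop z u) t)) D"
    proof (rule nth_equalityI)
      fix i assume "i < length (map (\<lambda>i. if homogeneous B i then Star (card (block B i)) else Plain (card (block B i)))
        [2..<length B])"
      then have i: "i < length D" by (simp add: lenB del: upt_Suc)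
      have "\<not> homogeneous B (i + 2)" by (rule nonhom) (use i lenB in simp)
      moreover have "card (block B (i + 2)) = count_list (drop z u) (D ! i)"
        unfolding b2[OF i] using cardD[of "D ! i"] i by (simp add: card_image)
      ultimately show "map (\<lambda>i. if homogeneous B i then Star (card (block B i)) else Plain (card (block B i)))
        [2..<length B] ! i = map (\<lambda>t. Plain (count_list (drop z u) t)) D ! i"
        using i lenB by (simp add: add.commute del: upt_Suc)
    qed (simp add: lenB del: upt_Suc)
    then show ?thesis
      unfolding sbp_type_def canonical_type_def at0_def[symmetric] D_def[symmetric] b1 cb0
      by simp
  qed

  show "sbp_point (data_vector u) B = x"
  proof (subst vec_eq_iff, rule allI)
    fix p
    have "sbp_point (data_vector u) B $ p = (if rk (Some p) = 0 then 0 else D ! (rk (Some p) - 2))"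
      by (rule sbp_point_rank[OF block rklt _ lenB D]) (simp_all add: rk_simps)
    then show "sbp_point (data_vector u) B $ p = x $ p" using ix(2)[of p] by (simp add: rk_simps)
  qed

  have ixlt: "rk (Some p) < rk (Some q) \<longleftrightarrow> x $ p < x $ q" for p q
  proof (cases "x $ p = 0 \<or> x $ q = 0")
    case True
    then show ?thesis using xge[of p] xge[of q] by (auto simp: rk_simps)
  next
    case False
    then show ?thesis using Dnth(1)[of "ix p" "ix q"] ix by (simp add: rk_simps)
  qed
  have rkN: "rk None < rk (Some q) \<longleftrightarrow> 0 < x $ q" "rk (Some q) < rk None \<longleftrightarrow> x $ q = 0 \<and> \<not> at0" for q
    using xge[of q] by (auto simp: rk_simps)
  \<comment> \<open>A zero coordinate makes \<open>z\<close> positive, so the failure of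
    \<open>at0\<close> can only mean that \<open>x\<close> has more zeros than \<open>u\<close>.
    This is the flag of \<open>vertex_cone\<close>.\<close>
  have "(x $ q = 0 \<and> \<not> at0) \<longleftrightarrow> (count_list u 0 < z \<and> x $ q = 0)" for q
  proof -
    have "0 < z" if "x $ q = 0"
      unfolding card0[symmetric] using that by (auto simp: card_gt_0_iff)
    then show ?thesis using z(1) by (auto simp: at0_def)
  qed
  note rkN = rkN[unfolded this]
  have le: "sbp_le B p q \<longleftrightarrow> p = q \<or> rk p < rk q" for p q
    by (rule sbp_le_rank[OF block rklt nonhom])
  have "c \<in> sliced_preorder_cone B \<longleftrightarrow> (\<forall>p q. rk p < rk q \<longrightarrow> coord0 c p \<le> coord0 c q)" for c
    unfolding sliced_preorder_cone_def le by auto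
  also have "\<dots> c \<longleftrightarrow> c \<in> vertex_cone (count_list u 0 < z) x" for c
    \<comment> \<open>Pairs of coordinates give the monotonicity conditions, and pairs involving the
      index 0 give the sign conditions.\<close>
    unfolding split_option_all vertex_cone_def using rkN ixlt by auto
  finally show "sliced_preorder_cone B = vertex_cone (count_list u 0 < z) x" by blast

  have "block B i \<noteq> {}" if i: "2 \<le> i" "i < length B" for i
  proof -
    obtain j where j: "j < length D" "i = j + 2" using cases_j[OF i(2)] i(1) by auto
    have "D ! j \<in> range (($) x)" using ran j by simp
    then show ?thesis unfolding j(2) b2[OF j(1)] by auto
  qed
  moreover have "(\<Union>i<length B. block B i) = UNIV" using block rklt by blast
  moreover have "block B i \<inter> block B j = {}" if "i < length B" "j < length B" "i \<noteq> j" for i j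
    using block[OF that(1)] block[OF that(2)] that(3) by auto
  moreover have "None \<in> block B 0 \<union> block B 1" unfolding b0 b1 by simp
  moreover have "2 \<le> card (block B 0) \<and> block B 1 = {}" if "None \<in> block B 0"
  proof -
    have at0 using that unfolding b0 by (auto split: if_splits)
    then show ?thesis unfolding cb0 b1 by (simp add: at0_def)
  qed
  moreover have "card (block B 1) \<le> 1" unfolding b1 by simp
  moreover have "2 \<le> length B" by (simp add: lenB)
  ultimately show "skewed_binary_partition B"
    unfolding skewed_binary_partition_def using nonhom[of 0] nonhom[of 1] nonhom by fastforce
qed

text \<open>The type fixes the labels, the block sizes and the place of the index 0. As the values
  in \<open>D\<close> are distinct and positive, the blocks are recovered as level sets of the
  point, and their sizes give its multiset of coordinates.\<close>

lemma partition_of_canonical_type: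
  fixes B :: "'n::finite blocks"
  assumes u: "valid_bound u" and len: "length u = CARD('n)"
    and z: "count_list u 0 \<le> z" "z \<le> length u"
    and B: "skewed_binary_partition B" and type: "sbp_type B = canonical_type u z"
  defines "x \<equiv> sbp_point (data_vector u) B"
  shows "vertex_level u z x" "B = level_partition u z x"
proof -
  define D where "D = levels u z"
  define at0 where "at0 \<longleftrightarrow> z = count_list u 0 \<and> 0 < z"
  note sbp = B[unfolded skewed_binary_partition_def]
  have D: "D = drop (length (data_vector u) - length D) (data_vector u)"
    unfolding D_def by (rule levels_eq_drop[OF u z])
  have Dset: "set D = set (drop z u)" unfolding D_def by (rule set_levels[OF u z(1)])
  have Dpos: "0 < t" if "t \<in> set D" for t
    using set_drop_positive[OF u z(1)] that Dset by blast
  have Ddist: "distinct D"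
    unfolding D_def levels_def by (intro distinct_filter data_vector_simps)
  have type': "sbp_type B = (if at0 then [Plain z, Plain 0] else [Plain z, Circ 0]) @
      map (\<lambda>t. Plain (count_list (drop z u) t)) D"
    using type unfolding canonical_type_def at0_def D_def .
  have "length (sbp_type B) = 2 + (length B - 2)" by (simp add: sbp_type_def)
  moreover have "length (sbp_type B) = 2 + length D" unfolding type' by simp
  ultimately have lenB: "length B = length D + 2" using sbp by linarith
  have disj: "block B i \<inter> block B j = {}" if "i < length B" "j < length B" "i \<noteq> j" for i j
    using sbp that by blast
  have "\<exists>j<length B. q \<in> block B j" for q
  proof -
    have "q \<in> (\<Union>i<length B. block B i)" using sbp by simp
    then show ?thesis by blast
  qed
  then obtain rk where rk: "\<And>q. rk q < length B" "\<And>q. q \<in> block B (rk q)" by metis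
  have block: "block B j = {q. rk q = j}" if "j < length B" for j
    using rk disj[OF rk(1) that] by blast
  have block0: "block B 0 = {q. rk q = 0}" and block1: "block B 1 = {q. rk q = 1}"
    using block lenB by simp_all
  have N01: "None \<in> block B 0 \<union> block B 1" using sbp by blast
  have tl: "map (\<lambda>i. if homogeneous B i then Star (card (block B i)) else Plain (card (block B i)))
      [2..<length B] = map (\<lambda>t. Plain (count_list (drop z u) t)) D"
    using arg_cong[OF type', of "drop 2"] unfolding sbp_type_def by simp
  have entry: "\<not> homogeneous B (j + 2)" "card (block B (j + 2)) = count_list (drop z u) (D ! j)"
    if "j < length D" for j
  proof -
    have "[2..<length B] ! j = j + 2" "j < length [2..<length B]" using that lenB by (simp_all del: upt_Suc)
    then have "(if homogeneous B (j + 2) then Star (card (block B (j + 2))) else Plain (card (block B (j + 2))))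
        = Plain (count_list (drop z u) (D ! j))"
      using arg_cong[OF tl, of "\<lambda>xs. xs ! j"] that by (simp del: upt_Suc cong: if_cong)
    then show "\<not> homogeneous B (j + 2)" "card (block B (j + 2)) = count_list (drop z u) (D ! j)"
      by (simp_all split: if_splits)
  qed
  \<comment> \<open>The undecorated \<open>Plain 0\<close> against \<open>Circ 0\<close> in second
    place reveals whether the index 0 lies in \<open>B_{-1}\<close> or in
    \<open>B_0\<close>.\<close>
  have hd: "(if None \<in> block B 1 then [Plain (card (block B 0)), Circ (card (block B 1) - 1)]
      else [Plain (card (block B 0) - 1), Plain 0]) = (if at0 then [Plain z, Plain 0] else [Plain z, Circ 0])"
    using arg_cong[OF type', of "take 2"] unfolding sbp_type_def by (simp split: if_splits)
  have N1: "None \<in> block B 1 \<longleftrightarrow> \<not> at0"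
    using hd by (simp split: if_splits)
  have b1: "block B 1 = (if at0 then {} else {None})"
  proof (cases at0)
    case True
    then have "None \<in> block B 0" using N01 N1 by blast
    then show ?thesis using sbp True by simp
  next
    case False
    then have N: "None \<in> block B 1" using N1 by simp
    have "card (block B 1) - 1 = 0" using hd False N by simp
    \<comment> \<open>The truncated subtraction would also allow an empty block; the element
      \<open>None\<close> excludes it.\<close>
    moreover have "card (block B 1) \<noteq> 0" using N by (metis card_eq_0_iff empty_iff finite)
    ultimately have "card (block B 1) = 1" by linarith
    then show ?thesis using N False by (metis card_1_singletonE singletonD)
  qed
  have N0: "None \<in> block B 0 \<longleftrightarrow> at0" using N01 N1 block0 block1 by auto
  have card0: "card (block B 0) = (if at0 then Suc z else z)"
  proof (cases at0)
    case True
    then have "card (block B 0) - 1 = z" using hd N1 by simp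
    moreover have "2 \<le> card (block B 0)" using sbp N0 True by blast
    ultimately show ?thesis using True by simp
  next
    case False
    then show ?thesis using hd N1 by simp
  qed
  have nonhom: "\<not> homogeneous B j" if "j < length B" for j
  proof -
    have "\<not> homogeneous B 0" using sbp by blast
    \<comment> \<open>If \<open>B_0\<close> is empty, its label is fixed by the normalization; if it
      is a singleton, by the rule for singletons.\<close>
    moreover have "\<not> homogeneous B 1"
      using sbp b1 lenB by (cases at0) simp_all
    moreover have "j = 0 \<or> j = 1 \<or> j = (j - 2) + 2 \<and> j - 2 < length D" using that lenB by linarith
    ultimately show ?thesis using entry(1)[of "j - 2"] by metis
  qed
  have rkS: "rk (Some p) \<noteq> 1" for p
    using block1 b1 by (auto split: if_splits)
  have xrk: "x $ p = (if rk (Some p) = 0 then 0 else D ! (rk (Some p) - 2))" for p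
    unfolding x_def by (rule sbp_point_rank[OF block rk(1) rkS lenB D])
  have rk2: "rk (Some p) \<ge> 2 \<and> rk (Some p) - 2 < length D" if "rk (Some p) \<noteq> 0" for p
    using rkS[of p] rk(1)[of "Some p"] that lenB by linarith
  have x0: "x $ p = 0 \<longleftrightarrow> Some p \<in> block B 0" for p
    using xrk[of p] rk2[of p] Dpos[OF nth_mem, of "rk (Some p) - 2"] by (auto simp: block0)
  have xD: "x $ p = D ! j \<longleftrightarrow> Some p \<in> block B (j + 2)" if j: "j < length D" for p j
  proof -
    have "Some p \<in> block B (j + 2) \<longleftrightarrow> rk (Some p) = j + 2" using block[of "j + 2"] j lenB by simp
    also have "\<dots> \<longleftrightarrow> x $ p = D ! j"
    proof (cases "rk (Some p) = 0")
      case True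
      then show ?thesis using xrk[of p] Dpos[OF nth_mem[OF j]] by simp
    next
      case False
      have "D ! (rk (Some p) - 2) = D ! j \<longleftrightarrow> rk (Some p) - 2 = j"
        using nth_eq_iff_index_eq[OF Ddist] rk2[OF False] j by blast
      then show ?thesis using xrk[of p] False rk2[OF False] by auto
    qed
    finally show ?thesis ..
  qed
  have b0: "block B 0 = (if at0 then insert None (Some ` {p. x $ p = 0}) else Some ` {p. x $ p = 0})"
  proof (rule set_eqI)
    fix q show "q \<in> block B 0 \<longleftrightarrow> q \<in> (if at0 then insert None (Some ` {p. x $ p = 0}) else Some ` {p. x $ p = 0})"
      using N0 by (cases q) (auto simp: x0)
  qed
  have b2: "block B (j + 2) = Some ` {p. x $ p = D ! j}" if j: "j < length D" for j
  proof (rule set_eqI)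
    have "None \<notin> block B (j + 2)"
      using N01 block0 block1 block[of "j + 2"] j lenB by auto
    then show "q \<in> block B (j + 2) \<longleftrightarrow> q \<in> Some ` {p. x $ p = D ! j}" for q
      using xD[OF j] by (cases q) auto
  qed
  have c0: "card {p. x $ p = 0} = z"
    using card0 unfolding b0 by (simp add: card_image card_insert_if image_iff split: if_splits)
  have cD: "card {p. x $ p = t} = count_list (drop z u) t" if t: "t \<in> set D" for t
  proof -
    obtain j where j: "j < length D" "t = D ! j" using t by (metis in_set_conv_nth)
    show ?thesis using entry(2)[OF j(1)] unfolding b2[OF j(1)] j(2) by (simp add: card_image)
  qed
  have "image_mset (($) x) (mset_set UNIV) = mset (replicate z 0 @ drop z u)"
  proof (rule multiset_eqI)
    fix t
    consider "t = 0" | "t \<in> set D" | "t \<noteq> 0" "t \<notin> set D" by blast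
    then show "count (image_mset (($) x) (mset_set UNIV)) t = count (mset (replicate z 0 @ drop z u)) t"
    proof cases
      case 1
      have "0 \<notin> set (drop z u)" using Dpos[of 0] Dset by auto
      then show ?thesis
        using c0 1 by (simp add: count_image_mset_UNIV count_mset count_list_append count_list_replicate count_list_0_iff)
    next
      case 2
      then show ?thesis using cD[OF 2] Dpos[OF 2]
        by (simp add: count_image_mset_UNIV count_mset count_list_append count_list_replicate)
    next
      case 3
      have "{p. x $ p = t} = {}"
        using xrk rk2 3 by (metis (mono_tags, lifting) Collect_empty_eq nth_mem)
      then show ?thesis using 3 Dset
        by (simp add: count_image_mset_UNIV count_mset count_list_append count_list_replicate count_list_0_iff)
    qed
  qed
  then show "vertex_level u z x" using z by (simp add: vertex_level_def)
  have entries: "B ! j = (block B j, Nonhomogeneous)" if "j < length B" for j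
    using nonhom[OF that] unfolding block_def homogeneous_def
    by (cases "B ! j", cases "snd (B ! j)") simp_all
  have "level_partition u z x = (block B 0, Nonhomogeneous) # (block B 1, Nonhomogeneous) #
      map (\<lambda>t. (Some ` {p. x $ p = t}, Nonhomogeneous)) D"
    unfolding level_partition_def at0_def[symmetric] D_def[symmetric] b0 b1 by simp
  moreover have "B = \<dots>"
  proof (rule nth_equalityI)
    fix j assume j: "j < length B"
    then have "j = 0 \<or> j = 1 \<or> j = Suc (Suc (j - 2)) \<and> j - 2 < length D" using lenB by linarith
    then show "B ! j = ((block B 0, Nonhomogeneous) # (block B 1, Nonhomogeneous) #
      map (\<lambda>t. (Some ` {p. x $ p = t}, Nonhomogeneous)) D) ! j"
    proof (elim disjE conjE)
      assume js: "j = Suc (Suc (j - 2))" "j - 2 < length D"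
      then obtain i where i: "j = i + 2" "i < length D" by fastforce
      then show ?thesis using entries[OF j] b2[OF i(2)] by simp
    qed (use entries[OF j] in simp_all)
  qed (simp add: lenB)
  ultimately show "B = level_partition u z x" by simp
qed

section \<open>The bijection with the vertices and their normal cones\<close>

theorem theorem5p16:
  fixes m :: "nat list" and d :: "real list"
  assumes "is_MD_pair m d" and "magnitude m = CARD('n::finite)"
  shows "bij_betw (sbp_point d)
           {B :: 'n blocks. skewed_binary_partition B \<and> sbp_type B \<in> Omega m}
           {v :: real ^ 'n. v extreme_point_of PF_MD m d} \<and>
         (\<forall>B :: 'n blocks. skewed_binary_partition B \<and> sbp_type B \<in> Omega m \<longrightarrow>
           normal_cone (PF_MD m d) {sbp_point d B} = sliced_preorder_cone B)"
proof -
  obtain u where u: "valid_bound u" and m: "m = multiplicity_vector u" and d: "d = data_vector u"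
    using assms(1) unfolding is_MD_pair_def by blast
  have len: "length u = CARD('n)"
    using assms(2) magnitude_multiplicity_vector[OF u] m by simp
  have PF: "PF_MD m d = (PF u :: (real ^ 'n) set)"
    unfolding PF_MD_def m d bound_of_MD_recovers[OF u] ..
  let ?S = "{B :: 'n blocks. skewed_binary_partition B \<and> sbp_type B \<in> Omega m}"
  \<comment> \<open>Every admissible partition is the level partition of its own point; this yields
    injectivity, extremality of the image and the normal cones.\<close>
  have dec: "\<exists>z. vertex_level u z (sbp_point d B) \<and> B = level_partition u z (sbp_point d B)"
    if "B \<in> ?S" for B
  proof -
    have "sbp_type B \<in> canonical_type u ` {count_list u 0..length u}"
      using that unfolding m Omega_multiplicity_vector[OF u] by simp
    then obtain z where "sbp_type B = canonical_type u z" "z \<in> {count_list u 0..length u}"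
      by (rule imageE)
    then show ?thesis
      using partition_of_canonical_type[OF u len, of z B] that unfolding d by auto
  qed
  have inj: "inj_on (sbp_point d) ?S"
  proof (rule inj_onI)
    fix B B' assume "B \<in> ?S" "B' \<in> ?S" and eq: "sbp_point d B = sbp_point d B'"
    then obtain z z' where "vertex_level u z (sbp_point d B)" "B = level_partition u z (sbp_point d B)"
        "vertex_level u z' (sbp_point d B)" "B' = level_partition u z' (sbp_point d B)"
      using dec by metis
    \<comment> \<open>Both levels equal the number of zeros of the common point, so the two level
      partitions coincide.\<close>
    then show "B = B'" using vertex_level_card_zero[OF u len] by metis
  qed
  have "sbp_point d ` ?S = {v. v extreme_point_of PF_MD m d}"
  proof (intro set_eqI iffI)
    fix v assume "v \<in> sbp_point d ` ?S"
    then show "v \<in> {v. v extreme_point_of PF_MD m d}"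
      using dec unfolding PF extreme_point_PF_iff[OF u len] by blast
  next
    fix v :: "real ^ 'n" assume "v \<in> {v. v extreme_point_of PF_MD m d}"
    then obtain z where z: "vertex_level u z v"
      unfolding PF extreme_point_PF_iff[OF u len] by blast
    have "canonical_type u z \<in> Omega m"
      unfolding m Omega_multiplicity_vector[OF u] using z by (auto simp: vertex_level_def)
    then have "level_partition u z v \<in> ?S" "v = sbp_point d (level_partition u z v)"
      using level_partition_properties[OF u len z] d by simp_all
    then show "v \<in> sbp_point d ` ?S" by blast
  qed
  moreover have "normal_cone (PF_MD m d) {sbp_point d B} = sliced_preorder_cone B"
    if "B \<in> ?S" for B
    using dec[OF that] normal_cone_vertex[OF u len] level_partition_properties(4)[OF u len]
    unfolding PF by metis
  ultimately show ?thesis using inj by (simp add: bij_betw_def)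
qed

end
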